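(* Let $\mathcal A$ be a finite or countable alphabet, $X=\mathcal A^{\mathbb N}$, $T:X\to X$ the shift, and let $g(x)=g_0\prod_{i=1}^\infty g_i(x_i)$ be an $\ell_1$-bounded, summable potential function of product type. Put $\lambda=g_0\sum_{a\in\mathcal A}\prod_{k=1}^\infty g_k(a)$, let $\mu=\otimes_{n=1}^\infty\mu_n$ be the product measure with $\mu_n(a)=\prod_{i=1}^n g_i(a)\big/\sum_{b\in\mathcal A}\prod_{i=1}^n g_i(b)$, and let $\tilde\mu$ be the stationary Bernoulli measure with weights $\tilde\mu_0(a)=\prod_{i=1}^\infty g_i(a)\big/\sum_{b\in\mathcal A}\prod_{i=1}^\infty g_i(b)$. (1) There is at most one $h\in L^1(X,\mu)$ with $\mathcal L_{\log g}(h)=\lambda h$ and $\int h\,d\mu=1$. (2) If, for some $k\in\mathbb N$, $$\sum_{i=k}^\infty\sup_{a\in\mathcal A}\Big(\sum_{j=i}^\infty\log g_j(a)\Big)^2<\infty,$$ then the function $$h_\mu((x_j)_{j\ge1})=\prod_{j=1}^\infty\left(\frac{\sum_{a\in\mathcal A}\prod_{l=1}^j g_l(a)}{\sum_{a\in\mathcal A}\prod_{l=1}^\infty g_l(a)}\prod_{l=1}^\infty g_{l+j}(x_j)\right)$$ is in $L^1(X,\mu)$. Furthermore, $\int h_\mu\,d\mu=1$, $\mathcal L_{\log g}(h_\mu)=\lambda h_\mu$ and $d\tilde\mu=h_\mu\,d\mu$. (3) (Without assuming the condition in (2).) The function $h_\mu$ exists $\mu$-a.s. Moreover, $\int h_\mu\,d\mu>0$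 if and only if $\mu$ and $\tilde\mu$ are equivalent. If $\int h_\mu\,d\mu=0$, then $\tilde\mu$ and $\mu$ are singular measures.
   Context: $X=\mathcal A^{\mathbb N}$ carries the product topology and its Borel $\sigma$-algebra; $T(x_1,x_2,\ldots)=(x_2,x_3,\ldots)$. A function $g:X\to(0,\infty)$ is of product type if $g(x)=g_0\prod_{i\ge1}g_i(x_i)$ with a constant $g_0>0$ and $g_i:\mathcal A\to(0,\infty)$ such that $\sum_i\log g_i(x_i)$ converges for all $x$. It is $\ell_1$-bounded if $\sum_{k=2}^\infty\|\log g_k\|_\infty<\infty$ and summable if $\sum_{a\in\mathcal A}g_1(a)<\infty$. Ruelle operator: $\mathcal L_{\log g}\phi(x)=\sum_{T(y)=x}\phi(y)g(y)$; under the present hypotheses it acts on $L^1(X,\mu)$. The infinite product over $j$ defining $h_\mu$ is the limit of its partial products; "exists" means that this limit exists in $[0,\infty)$. Two measures are equivalent if they are mutually absolutely continuous. *)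

theory Defs
  imports "HOL-Probability.Probability"
begin

text \<open>
  The alphabet is a type \<open>'a :: countable\<close> (finite or countably infinite, nonempty).
  All sequences are indexed from 0: \<open>x i\<close> stands for the coordinate $x_{i+1}$, and \<open>f i\<close> for
  the factor $g_{i+1}$ of the potential. The constant $g_0$ is the separate parameter \<open>g0\<close>.
  Measures on the sequence space live on the product \<open>\<sigma>\<close>-algebra of the discrete \<open>\<sigma>\<close>-algebras;
  as the alphabet is countable, this is the Borel \<open>\<sigma>\<close>-algebra of the product topology.
\<close>

definition shift :: "(nat \<Rightarrow> 'a) \<Rightarrow> (nat \<Rightarrow> 'a)" where
  "shift x = (\<lambda>i. x (Suc i))"

definition product_type ::
  "((nat \<Rightarrow> 'a) \<Rightarrow> real) \<Rightarrow> real \<Rightarrow> (nat \<Rightarrow> 'a \<Rightarrow> real) \<Rightarrow> bool" where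
  "product_type g g0 f \<longleftrightarrow>
     g0 > 0 \<and> (\<forall>i a. f i a > 0) \<and>
     (\<forall>x :: nat \<Rightarrow> 'a. summable (\<lambda>i. ln (f i (x i)))) \<and>
     (\<forall>x. g x = g0 * (\<Prod>i. f i (x i)))"

text \<open>Suprema and sums are taken in \<open>ennreal\<close>, so that an unbounded supremum counts as infinite.\<close>

definition l1_bounded :: "(nat \<Rightarrow> 'a \<Rightarrow> real) \<Rightarrow> bool" where
  "l1_bounded f \<longleftrightarrow> (\<Sum>k. SUP a. ennreal \<bar>ln (f (Suc k) a)\<bar>) < \<infinity>"

definition summable_potential :: "(nat \<Rightarrow> 'a \<Rightarrow> real) \<Rightarrow> bool" where
  "summable_potential f \<longleftrightarrow> f 0 summable_on UNIV"

text \<open>The Ruelle operator of \<open>log g\<close>, i.e. with weight \<open>g = exp (log g)\<close>.\<close>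

definition ruelle ::
  "((nat \<Rightarrow> 'a) \<Rightarrow> real) \<Rightarrow> ((nat \<Rightarrow> 'a) \<Rightarrow> real) \<Rightarrow> (nat \<Rightarrow> 'a) \<Rightarrow> real" where
  "ruelle g \<phi> x = (\<Sum>\<^sub>\<infinity>y\<in>{y. shift y = x}. \<phi> y * g y)"

definition ruelle_eigenvalue :: "real \<Rightarrow> (nat \<Rightarrow> 'a \<Rightarrow> real) \<Rightarrow> real" where
  "ruelle_eigenvalue g0 f = g0 * (\<Sum>\<^sub>\<infinity>a. \<Prod>k. f k a)"

definition weighted_measure :: "('a \<Rightarrow> real) \<Rightarrow> 'a measure" where
  "weighted_measure w = density (count_space UNIV) (\<lambda>a. ennreal (w a / (\<Sum>\<^sub>\<infinity>b. w b)))"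

definition mu :: "(nat \<Rightarrow> 'a :: countable \<Rightarrow> real) \<Rightarrow> (nat \<Rightarrow> 'a) measure" where
  "mu f = (\<Pi>\<^sub>M n\<in>UNIV. weighted_measure (\<lambda>a. \<Prod>i\<le>n. f i a))"

definition mu_tilde :: "(nat \<Rightarrow> 'a :: countable \<Rightarrow> real) \<Rightarrow> (nat \<Rightarrow> 'a) measure" where
  "mu_tilde f = (\<Pi>\<^sub>M n\<in>UNIV. weighted_measure (\<lambda>a. \<Prod>i. f i a))"

text \<open>
  The factor with index \<open>j\<close> below is the factor with index $j+1$ in the one-based product
  $$\prod_{j\ge1}\Big(\frac{\sum_a\prod_{l=1}^j g_l(a)}{\sum_a\prod_{l=1}^\infty g_l(a)}
    \prod_{l=1}^\infty g_{l+j}(x_j)\Big).$$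
  This product may well converge to 0, a limit that \<^const>\<open>convergent_prod\<close> and
  \<^const>\<open>prodinf\<close> do not admit when all factors are nonzero; hence the explicit limit of
  partial products.
\<close>

definition h_factor :: "(nat \<Rightarrow> 'a \<Rightarrow> real) \<Rightarrow> (nat \<Rightarrow> 'a) \<Rightarrow> nat \<Rightarrow> real" where
  "h_factor f x j =
     (\<Sum>\<^sub>\<infinity>a. \<Prod>l\<le>j. f l a) / (\<Sum>\<^sub>\<infinity>a. \<Prod>l. f l a) * (\<Prod>l. f (l + Suc j) (x j))"

definition h_mu_exists :: "(nat \<Rightarrow> 'a \<Rightarrow> real) \<Rightarrow> (nat \<Rightarrow> 'a) \<Rightarrow> bool" where
  "h_mu_exists f x \<longleftrightarrow> (\<exists>L\<ge>0. (\<lambda>n. \<Prod>j<n. h_factor f x j) \<longlonglongrightarrow> L)"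

text \<open>The value 0 off the set of existence is a convention.\<close>

definition h_mu :: "(nat \<Rightarrow> 'a \<Rightarrow> real) \<Rightarrow> (nat \<Rightarrow> 'a) \<Rightarrow> real" where
  "h_mu f x = (if h_mu_exists f x then lim (\<lambda>n. \<Prod>j<n. h_factor f x j) else 0)"

definition equivalent_measures :: "'b measure \<Rightarrow> 'b measure \<Rightarrow> bool" where
  "equivalent_measures M N \<longleftrightarrow> absolutely_continuous M N \<and> absolutely_continuous N M"

definition singular_measures :: "'b measure \<Rightarrow> 'b measure \<Rightarrow> bool" where
  "singular_measures M N \<longleftrightarrow>
     sets M = sets N \<and> (\<exists>S\<in>sets M. emeasure M S = 0 \<and> emeasure N (space N - S) = 0)"

end

theory Submission
  imports Defs
begin

text \<open>
  The partial products of $h_\mu$ are the likelihood ratios of $\tilde\mu$ against $\mu$ on the first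
  $n$ coordinates, so (3) is Kakutani's dichotomy. Let $\rho_j$ be the Hellinger affinity of the $j$-th
  marginals. If $\sum_j (1-\rho_j) < \infty$, then the tail products are close to 1 in $L^1$, and the
  maximal inequality for submartingales gives an almost surely positive limit, which is the density of
  $\tilde\mu$. Otherwise $\prod_j \rho_j = 0$: the square roots of the partial products are a
  supermartingale with vanishing mean, so the products tend to 0 $\mu$-a.s., while Fatou's lemma for
  their inverse square roots under $\tilde\mu$ excludes this limit $\tilde\mu$-a.s.
  The condition of (2) implies $\sum_j (1-\rho_j) < \infty$, since $1-\rho_j$ is at most a constant times
  $\sup_a (\sum_{i>j} \log g_i(a))^2$; the eigenvalue equation of $h_\mu$ is a telescoping identity
  which holds at every point.

  For (1), the same dichotomy gives the density of $\mu\circ T^{-1}$ with respect to $\mu$, whence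
  $\int (\phi\circ T)\, h\, d\mu = \int \phi\, \lambda^{-1} \mathcal L_{\log g} h\, d\mu$ for bounded
  $\phi$. If $h$ is an eigenfunction of integral 1, then
  $\int \phi h\, d\mu = \int (\phi\circ T^n)\, h\, d\mu$, which differs from
  $\int \phi\circ T^n\, d\mu$ by a null sequence because $\mu$ is a product measure. The latter integrals
  do not depend on $h$.
\<close>

section \<open>Products of probability spaces\<close>

text \<open>Conditional expectations are replaced by splicing two independent samples, so the
  martingale estimates only involve events determined by finitely many coordinates.

  The L1 estimate of the first case rests on factoring y - 1 as (sqrt y - 1)(sqrt y + 1). For the
  likelihood ratio L of a block of coordinates, the mean of (sqrt L - 1)^2 is 2(1 - R), where R is
  the product of the affinities in the block. Tail blocks are essential: the product from coordinate
  0 on need not be near 1, whereas a tail staying near 1 gives convergence and a positive limit at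
  once.

  The dichotomy is applied to two pairs of measures. Comparing marginal n with its limit leaves a
  whole tail of the potential; l1-boundedness makes it small, but its squares need not be summable,
  so both cases occur. Comparing marginal n with marginal n+1 leaves the single factor
  \<open>f (Suc n)\<close>, whose logarithms have summable norms; this is always the first case.

  In (1) there is no invariance of \<open>mu f\<close> to rely on, and an eigenfunction may change
  sign. Hence uniqueness is read off from integrals over arbitrary measurable sets.\<close>

definition splice_at :: "nat \<Rightarrow> (nat \<Rightarrow> 'b) \<times> (nat \<Rightarrow> 'b) \<Rightarrow> nat \<Rightarrow> 'b" where
  "splice_at n = (\<lambda>(x, y) i. if i < n then x i else y i)"

locale sequence_prob_space = product_prob_space M "UNIV :: nat set" for M :: "nat \<Rightarrow> 'b measure"
begin

abbreviation "PM \<equiv> Pi\<^sub>M UNIV M"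

lemma measurable_splice_at [measurable]: "splice_at n \<in> measurable (PM \<Otimes>\<^sub>M PM) PM"
  unfolding splice_at_def split_beta'
proof (rule measurable_PiM_single')
  fix i :: nat
  show "(\<lambda>\<omega>. if i < n then fst \<omega> i else snd \<omega> i) \<in> measurable (PM \<Otimes>\<^sub>M PM) (M i)"
    by (cases "i < n") (auto intro: measurable_compose[OF measurable_fst measurable_component_singleton]
        measurable_compose[OF measurable_snd measurable_component_singleton])
qed (auto simp: space_pair_measure space_PiM PiE_iff)

text \<open>The preimage of a cylinder over J is a rectangle, with one side a cylinder over
  \<open>J \<inter> {..<n}\<close> and the other over \<open>J - {..<n}\<close>. So the two laws
  agree on a generator. This encodes the independence of the first n coordinates from the
  others.\<close>

lemma distr_splice_at: "distr (PM \<Otimes>\<^sub>M PM) PM (splice_at n) = PM"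
proof (rule PiM_eq)
  fix J :: "nat set" and F
  assume J: "finite J" "J \<subseteq> UNIV" and F: "\<And>j. j \<in> J \<Longrightarrow> F j \<in> sets (M j)"
  let ?A = "prod_emb UNIV M (J \<inter> {..<n}) (\<Pi>\<^sub>E j\<in>J \<inter> {..<n}. F j)"
  let ?B = "prod_emb UNIV M (J - {..<n}) (\<Pi>\<^sub>E j\<in>J - {..<n}. F j)"
  let ?E = "prod_emb UNIV M J (\<Pi>\<^sub>E j\<in>J. F j)"
  have meas: "?A \<in> sets PM" "?B \<in> sets PM" "?E \<in> sets PM"
    using J F by (auto intro!: sets_PiM_I)
  have sp: "F j \<subseteq> space (M j)" if "j \<in> J" for j using F[OF that] by (rule sets.sets_into_space)
  have "splice_at n -` ?E \<inter> space (PM \<Otimes>\<^sub>M PM) = ?A \<times> ?B"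
  proof (intro equalityI subsetI)
    fix p assume p: "p \<in> splice_at n -` ?E \<inter> space (PM \<Otimes>\<^sub>M PM)"
    obtain x y where [simp]: "p = (x, y)" by (cases p)
    show "p \<in> ?A \<times> ?B" using p
      by (auto simp: prod_emb_def splice_at_def space_pair_measure space_PiM PiE_iff extensional_def split: if_splits)
  next
    fix p assume p: "p \<in> ?A \<times> ?B"
    obtain x y where [simp]: "p = (x, y)" by (cases p)
    show "p \<in> splice_at n -` ?E \<inter> space (PM \<Otimes>\<^sub>M PM)" using p
      by (auto simp: prod_emb_def splice_at_def space_pair_measure space_PiM PiE_iff extensional_def)
  qed
  then have "emeasure (distr (PM \<Otimes>\<^sub>M PM) PM (splice_at n)) ?E = emeasure (PM \<Otimes>\<^sub>M PM) (?A \<times> ?B)"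
    using meas by (simp add: emeasure_distr)
  also have "\<dots> = emeasure PM ?A * emeasure PM ?B"
    using meas by (simp add: P.emeasure_pair_measure_Times)
  also have "\<dots> = (\<Prod>j\<in>J \<inter> {..<n}. emeasure (M j) (F j)) * (\<Prod>j\<in>J - {..<n}. emeasure (M j) (F j))"
    using J F by (intro arg_cong2[where f = "(*)"] emeasure_PiM_emb) (auto intro: M.prob_space_axioms)
  also have "\<dots> = (\<Prod>j\<in>J. emeasure (M j) (F j))"
    using J by (subst prod.Int_Diff[of J _ "{..<n}"]) auto
  finally show "emeasure (distr (PM \<Otimes>\<^sub>M PM) PM (splice_at n)) ?E = (\<Prod>j\<in>J. emeasure (M j) (F j))" .
qed simp

lemma nn_integral_splice_at:
  assumes [measurable]: "u \<in> borel_measurable PM"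
  shows "(\<integral>\<^sup>+ x. u x \<partial>PM) = (\<integral>\<^sup>+ x. \<integral>\<^sup>+ y. u (splice_at n (x, y)) \<partial>PM \<partial>PM)"
proof -
  have "(\<integral>\<^sup>+ x. u x \<partial>PM) = (\<integral>\<^sup>+ p. u (splice_at n p) \<partial>(PM \<Otimes>\<^sub>M PM))"
    by (subst distr_splice_at[of n, symmetric]) (simp add: nn_integral_distr)
  also have "\<dots> = (\<integral>\<^sup>+ x. \<integral>\<^sup>+ y. u (splice_at n (x, y)) \<partial>PM \<partial>PM)"
    by (subst P.nn_integral_fst[symmetric]) auto
  finally show ?thesis .
qed

lemma splice_at_lt: "\<forall>i<n. splice_at n (x, y) i = x i"
  and splice_at_ge: "\<forall>i\<ge>n. splice_at n (x, y) i = y i"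
  by (auto simp: splice_at_def)

lemma splice_at_in_space: "x \<in> space PM \<Longrightarrow> y \<in> space PM \<Longrightarrow> splice_at n (x, y) \<in> space PM"
  using measurable_space[OF measurable_splice_at, of "(x, y)" n] by (simp add: space_pair_measure)

text \<open>Dependence on a block of coordinates is expressed by agreement of points instead of
  measurability for a sub-sigma-algebra. After splicing, u sees only the first sample and v only the
  second, and the double integral factors.\<close>

lemma nn_integral_mult_indep:
  assumes [measurable]: "u \<in> borel_measurable PM" "v \<in> borel_measurable PM"
    and u: "\<And>x y. x \<in> space PM \<Longrightarrow> y \<in> space PM \<Longrightarrow> \<forall>i<n. x i = y i \<Longrightarrow> u x = u y"
    and v: "\<And>x y. x \<in> space PM \<Longrightarrow> y \<in> space PM \<Longrightarrow> \<forall>i\<ge>n. x i = y i \<Longrightarrow> v x = v y"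
  shows "(\<integral>\<^sup>+ x. u x * v x \<partial>PM) = (\<integral>\<^sup>+ x. u x \<partial>PM) * (\<integral>\<^sup>+ x. v x \<partial>PM)"
proof -
  have uv: "u (splice_at n (x, y)) = u x" "v (splice_at n (x, y)) = v y"
    if "x \<in> space PM" "y \<in> space PM" for x y
    by (rule u v, use that in \<open>simp_all add: splice_at_in_space splice_at_lt splice_at_ge\<close>)+
  have "(\<integral>\<^sup>+ x. u x * v x \<partial>PM) = (\<integral>\<^sup>+ x. \<integral>\<^sup>+ y. u x * v y \<partial>PM \<partial>PM)"
    by (subst nn_integral_splice_at[of _ n]) (auto simp: uv intro!: nn_integral_cong)
  then show ?thesis by (simp add: nn_integral_cmult nn_integral_multc)
qed

lemma nn_integral_component:
  assumes [measurable]: "u \<in> borel_measurable (M i)"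
  shows "(\<integral>\<^sup>+ x. u (x i) \<partial>PM) = (\<integral>\<^sup>+ a. u a \<partial>M i)"
  by (subst PiM_component[of i, symmetric]) (simp_all add: nn_integral_distr)

lemma nn_integral_prod_components:
  assumes meas [measurable]: "\<And>j. \<phi> j \<in> borel_measurable (M j)" and "k \<le> m"
  shows "(\<integral>\<^sup>+ x. (\<Prod>j\<in>{k..<m}. \<phi> j (x j)) \<partial>PM) = (\<Prod>j\<in>{k..<m}. (\<integral>\<^sup>+ a. \<phi> j a \<partial>M j))"
  using \<open>k \<le> m\<close>
proof (induction rule: dec_induct)
  case base
  then show ?case by (simp add: emeasure_space_1)
next
  case (step m)
  have "(\<integral>\<^sup>+ x. (\<Prod>j\<in>{k..<m}. \<phi> j (x j)) * \<phi> m (x m) \<partial>PM)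
      = (\<integral>\<^sup>+ x. (\<Prod>j\<in>{k..<m}. \<phi> j (x j)) \<partial>PM) * (\<integral>\<^sup>+ x. \<phi> m (x m) \<partial>PM)"
    by (rule nn_integral_mult_indep[where n = m]) (auto intro!: prod.cong)
  then show ?case using step by (simp add: nn_integral_component)
qed

lemma measurable_prod_components [measurable]:
  fixes \<phi> :: "nat \<Rightarrow> 'b \<Rightarrow> real"
  assumes [measurable]: "\<And>j. \<phi> j \<in> borel_measurable (M j)"
  shows "(\<lambda>x. \<Prod>j\<in>J. \<phi> j (x j)) \<in> borel_measurable PM"
  by measurable

end

lemma sequence_prob_spaceI:
  assumes "\<And>i. prob_space (M i)"
  shows "sequence_prob_space M"
proof -
  interpret prob_space "M i" for i by (rule assms)
  show ?thesis by unfold_locales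
qed

text \<open>Doob's inequality with the submartingale property required only on the events where the
  level e has been passed, so no filtration appears. In the induction, the newly added part of the
  event is paid for by \<open>X (Suc n)\<close>, which exceeds e there.\<close>

lemma submartingale_maximal_inequality:
  fixes X :: "nat \<Rightarrow> 'b \<Rightarrow> ennreal"
  assumes [measurable]: "\<And>i. X i \<in> borel_measurable P"
    and step: "\<And>n. k \<le> n \<Longrightarrow>
      (\<integral>\<^sup>+ x. X n x * indicator {x\<in>space P. \<exists>i\<in>{k..n}. e < X i x} x \<partial>P) \<le>
      (\<integral>\<^sup>+ x. X (Suc n) x * indicator {x\<in>space P. \<exists>i\<in>{k..n}. e < X i x} x \<partial>P)"
    and "k \<le> n"
  shows "e * emeasure P {x\<in>space P. \<exists>i\<in>{k..n}. e < X i x} \<le>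
    (\<integral>\<^sup>+ x. X n x * indicator {x\<in>space P. \<exists>i\<in>{k..n}. e < X i x} x \<partial>P)"
  using \<open>k \<le> n\<close>
proof (induction rule: dec_induct)
  case base
  have "e * emeasure P {x\<in>space P. \<exists>i\<in>{k..k}. e < X i x}
      = (\<integral>\<^sup>+ x. e * indicator {x\<in>space P. \<exists>i\<in>{k..k}. e < X i x} x \<partial>P)"
    by (subst nn_integral_cmult_indicator) auto
  also have "\<dots> \<le> (\<integral>\<^sup>+ x. X k x * indicator {x\<in>space P. \<exists>i\<in>{k..k}. e < X i x} x \<partial>P)"
    by (rule nn_integral_mono) (auto simp: indicator_def)
  finally show ?case .
next
  case (step n)
  define C where "C m = {x\<in>space P. \<exists>i\<in>{k..m}. e < X i x}" for m
  have [measurable]: "C m \<in> sets P" for m unfolding C_def by measurable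
  have CS: "C (Suc n) = C n \<union> {x\<in>space P. e < X (Suc n) x}"
    using step(1) by (auto simp: C_def le_Suc_eq)
  have "e * emeasure P (C (Suc n)) = (\<integral>\<^sup>+ x. e * indicator (C (Suc n)) x \<partial>P)"
    by (subst nn_integral_cmult_indicator) auto
  also have "\<dots> \<le> (\<integral>\<^sup>+ x. e * indicator (C n) x + X (Suc n) x * indicator (C (Suc n) - C n) x \<partial>P)"
    by (rule nn_integral_mono) (auto simp: indicator_def CS)
  also have "\<dots> = e * emeasure P (C n) + (\<integral>\<^sup>+ x. X (Suc n) x * indicator (C (Suc n) - C n) x \<partial>P)"
    by (subst nn_integral_add) (auto simp: nn_integral_cmult_indicator)
  also have "\<dots> \<le> (\<integral>\<^sup>+ x. X (Suc n) x * indicator (C n) x \<partial>P)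
      + (\<integral>\<^sup>+ x. X (Suc n) x * indicator (C (Suc n) - C n) x \<partial>P)"
    using step(3) assms(2)[OF step(1)] by (intro add_right_mono) (auto simp: C_def intro: order_trans)
  also have "\<dots> = (\<integral>\<^sup>+ x. X (Suc n) x * indicator (C (Suc n)) x \<partial>P)"
    by (subst nn_integral_add[symmetric])
       (auto intro!: nn_integral_cong simp: indicator_def CS)
  finally show ?case by (simp add: C_def)
qed

text \<open>The induction follows the process frozen at the value e once it has passed e. Its
  integral does not increase, and at time k it is at most that of \<open>X k\<close>. Only events
  where the level has not yet been passed enter the hypothesis.\<close>

lemma supermartingale_maximal_inequality:
  fixes X :: "nat \<Rightarrow> 'b \<Rightarrow> ennreal"
  assumes [measurable]: "\<And>i. X i \<in> borel_measurable P"
    and step: "\<And>n. k \<le> n \<Longrightarrow>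
      (\<integral>\<^sup>+ x. X (Suc n) x * indicator {x\<in>space P. \<forall>i\<in>{k..n}. X i x \<le> e} x \<partial>P) \<le>
      (\<integral>\<^sup>+ x. X n x * indicator {x\<in>space P. \<forall>i\<in>{k..n}. X i x \<le> e} x \<partial>P)"
    and "k \<le> n"
  shows "e * emeasure P {x\<in>space P. \<exists>i\<in>{k..n}. e < X i x} \<le> (\<integral>\<^sup>+ x. X k x \<partial>P)"
proof -
  define C where "C m = {x\<in>space P. \<exists>i\<in>{k..m}. e < X i x}" for m
  have [measurable]: "C m \<in> sets P" for m unfolding C_def by measurable
  have alt: "{x\<in>space P. \<forall>i\<in>{k..m}. X i x \<le> e} = space P - C m" for m
    by (auto simp: C_def not_less)
  have "(\<integral>\<^sup>+ x. e * indicator (C n) x + X n x * indicator (space P - C n) x \<partial>P) \<le> (\<integral>\<^sup>+ x. X k x \<partial>P)"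
    using \<open>k \<le> n\<close>
  proof (induction rule: dec_induct)
    case base
    show ?case by (rule nn_integral_mono) (auto simp: indicator_def C_def)
  next
    case (step n)
    have CS: "C (Suc n) = C n \<union> {x\<in>space P. e < X (Suc n) x}"
      using step(1) by (auto simp: C_def le_Suc_eq)
    have "(\<integral>\<^sup>+ x. e * indicator (C (Suc n)) x + X (Suc n) x * indicator (space P - C (Suc n)) x \<partial>P)
      \<le> (\<integral>\<^sup>+ x. e * indicator (C n) x + X (Suc n) x * indicator (space P - C n) x \<partial>P)"
      by (rule nn_integral_mono) (auto simp: indicator_def CS)
    also have "\<dots> = (\<integral>\<^sup>+ x. e * indicator (C n) x \<partial>P) + (\<integral>\<^sup>+ x. X (Suc n) x * indicator (space P - C n) x \<partial>P)"
      by (subst nn_integral_add) auto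
    also have "\<dots> \<le> (\<integral>\<^sup>+ x. e * indicator (C n) x \<partial>P) + (\<integral>\<^sup>+ x. X n x * indicator (space P - C n) x \<partial>P)"
      using assms(2)[OF step(1)] by (intro add_left_mono) (simp add: alt)
    also have "\<dots> = (\<integral>\<^sup>+ x. e * indicator (C n) x + X n x * indicator (space P - C n) x \<partial>P)"
      by (subst nn_integral_add) auto
    finally show ?case using step(3) by order
  qed
  moreover have "e * emeasure P (C n) = (\<integral>\<^sup>+ x. e * indicator (C n) x \<partial>P)"
    by (subst nn_integral_cmult_indicator) auto
  moreover have "\<dots> \<le> (\<integral>\<^sup>+ x. e * indicator (C n) x + X n x * indicator (space P - C n) x \<partial>P)"
    by (rule nn_integral_mono) auto
  ultimately show ?thesis unfolding C_def by simp
qed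

section \<open>Kakutani's dichotomy\<close>

lemma abs_diff_one_le_AM_GM:
  fixes y s :: real
  assumes "0 \<le> y" "0 < s"
  shows "\<bar>y - 1\<bar> \<le> (y + 1 - 2 * sqrt y) / (2 * s) + s * (y + 1 + 2 * sqrt y) / 2"
proof -
  define w where "w = sqrt y"
  have w: "y = w\<^sup>2" "0 \<le> w" using assms by (auto simp: w_def)
  define p q where "p = \<bar>w - 1\<bar>" and "q = w + 1"
  have sq: "p\<^sup>2 = y + 1 - 2 * sqrt y" "q\<^sup>2 = y + 1 + 2 * sqrt y"
    by (auto simp: p_def q_def w_def[symmetric] w power2_eq_square algebra_simps)
  have "\<bar>y - 1\<bar> = \<bar>(w - 1) * (w + 1)\<bar>" by (simp add: w power2_eq_square algebra_simps)
  also have "\<dots> = p * q" using w(2) by (simp add: p_def q_def abs_mult)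
  \<comment> \<open>The weight s is free because \<open>p\<close> will be small in mean square while
    \<open>q\<close> is merely bounded; s is later chosen of the order of the root mean square of
    \<open>p\<close>.\<close>
  also have "\<dots> \<le> p\<^sup>2 / (2 * s) + s * q\<^sup>2 / 2"
  proof -
    have "0 \<le> (p - s * q)\<^sup>2 / (2 * s)" using assms by simp
    also have "\<dots> = p\<^sup>2 / (2 * s) + s * q\<^sup>2 / 2 - p * q"
      using assms by (simp add: power2_eq_square field_simps)
    finally show ?thesis by simp
  qed
  finally show ?thesis by (simp only: sq)
qed

lemma abs_ln_le_of_near_one:
  fixes y e :: real
  assumes "\<bar>y - 1\<bar> \<le> e" "e \<le> 1/2"
  shows "\<bar>ln y\<bar> \<le> 2 * e"
proof -
  have e: "0 \<le> e" "1/2 \<le> y" using assms by auto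
  have "ln y \<le> y - 1" using e by (intro ln_le_minus_one) auto
  then have 1: "ln y \<le> 2 * e" using assms e by linarith
  have "- ln y = ln (1 / y)" using e by (simp add: ln_div)
  also have "\<dots> \<le> 1 / y - 1" using e by (intro ln_le_minus_one) auto
  also have "\<dots> = (1 - y) / y" using e by (simp add: field_simps)
  also have "\<dots> \<le> 2 * e"
  proof -
    have "1 - y \<le> e" using assms by linarith
    also have "e \<le> 2 * e * y" using mult_left_mono[OF e(2), of "2 * e"] e by simp
    finally show ?thesis using e by (simp add: divide_le_eq)
  qed
  finally show ?thesis using 1 by simp
qed

text \<open>Tail products near 1 make the partial sums of logarithms Cauchy, and the exponential of
  their limit is positive. The starting index of the tail may depend on the tolerance.\<close>

lemma partial_products_converge_pos:
  fixes c :: "nat \<Rightarrow> real"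
  assumes pos: "\<And>j. 0 < c j"
    and near: "\<And>n. \<exists>k. \<forall>m\<ge>k. \<bar>(\<Prod>j\<in>{k..<m}. c j) - 1\<bar> \<le> 1 / real (Suc n)"
  shows "\<exists>l>0. (\<lambda>n. \<Prod>j<n. c j) \<longlonglongrightarrow> l"
proof -
  define s where "s n = (\<Sum>j<n. ln (c j))" for n
  have nz: "c j \<noteq> 0" for j using pos[of j] by simp
  have "Cauchy s"
  proof (rule CauchyI')
    fix e :: real assume "0 < e"
    \<comment> \<open>The logarithm at most doubles the tolerance, provided this is at most 1/2, and
      two sums are compared through \<open>s k\<close>; hence e / 4.\<close>
    then obtain n where n: "1 / real (Suc n) < min (e / 4) (1 / 2)"
      using nat_approx_posE[of "min (e / 4) (1 / 2)"] by auto
    then obtain k where k: "\<And>m. k \<le> m \<Longrightarrow> \<bar>(\<Prod>j\<in>{k..<m}. c j) - 1\<bar> \<le> 1 / real (Suc n)"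
      using near[of n] by blast
    have close: "\<bar>s m - s k\<bar> < e / 2" if "k \<le> m" for m
    proof -
      have "s m - s k = (\<Sum>j\<in>{k..<m}. ln (c j))"
        using sum_diff_nat_ivl[of 0 k m "\<lambda>j. ln (c j)"] that by (simp add: s_def lessThan_atLeast0)
      also have "\<dots> = ln (\<Prod>j\<in>{k..<m}. c j)"
        using nz by (subst ln_prod) auto
      finally have "\<bar>s m - s k\<bar> \<le> 2 * (1 / real (Suc n))"
        using abs_ln_le_of_near_one[OF k[OF that]] n by simp
      then show ?thesis using n by simp
    qed
    show "\<exists>M. \<forall>m\<ge>M. \<forall>n>m. dist (s m) (s n) < e"
    proof (intro exI[of _ k] allI impI)
      fix m n assume "k \<le> m" "m < n"
      then show "dist (s m) (s n) < e" using close[of m] close[of n] unfolding dist_real_def by linarith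
    qed
  qed
  then obtain l where "s \<longlonglongrightarrow> l" using Cauchy_convergent_iff convergent_def by blast
  then have "(\<lambda>n. exp (s n)) \<longlonglongrightarrow> exp l" by (rule tendsto_exp)
  moreover have "exp (s n) = (\<Prod>j<n. c j)" for n
    using pos by (simp add: s_def exp_sum)
  ultimately show ?thesis by (intro exI[of _ "exp l"]) simp
qed

lemma sqrt_prod: "sqrt (\<Prod>j\<in>J. c j) = (\<Prod>j\<in>J. sqrt (c j))"
  by (induction J rule: infinite_finite_induct) (simp_all add: real_sqrt_mult)

section \<open>Likelihood ratios of product measures and Hellinger affinities\<close>

locale kakutani = sequence_prob_space M for M :: "nat \<Rightarrow> 'b measure" +
  fixes r :: "nat \<Rightarrow> 'b \<Rightarrow> real"
  assumes measurable_r [measurable]: "\<And>j. r j \<in> borel_measurable (M j)"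
    and r_pos: "\<And>j a. 0 < r j a"
    and nn_integral_r: "\<And>j. (\<integral>\<^sup>+ a. ennreal (r j a) \<partial>M j) = 1"
begin

abbreviation "QM \<equiv> Pi\<^sub>M UNIV (\<lambda>j. density (M j) (\<lambda>a. ennreal (r j a)))"

text \<open>The starting index k is there for the tails: \<open>lik k m\<close> can be close to 1
  for large k even where \<open>lik 0 m\<close> is not.\<close>

definition lik :: "nat \<Rightarrow> nat \<Rightarrow> (nat \<Rightarrow> 'b) \<Rightarrow> real" where
  "lik k m x = (\<Prod>j\<in>{k..<m}. r j (x j))"

definition rho :: "nat \<Rightarrow> real" where
  "rho j = (LINT a|M j. sqrt (r j a))"

lemma measurable_lik [measurable]: "lik k m \<in> borel_measurable PM"
  unfolding lik_def by measurable

lemma lik_pos: "0 < lik k m x"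
  unfolding lik_def by (intro prod_pos) (auto simp: r_pos)

lemma lik_Suc: "k \<le> n \<Longrightarrow> lik k (Suc n) x = lik k n x * r n (x n)"
  by (simp add: lik_def)

lemma lik_mult: "k \<le> m \<Longrightarrow> m \<le> n \<Longrightarrow> lik k m x * lik m n x = lik k n x"
  unfolding lik_def by (rule prod.atLeastLessThan_concat)

lemma lik_cong: "(\<And>i. i < m \<Longrightarrow> x i = y i) \<Longrightarrow> lik k m x = lik k m y"
  unfolding lik_def by (intro prod.cong) auto

lemma integrable_r: "integrable (M j) (r j)"
  and integral_r: "(LINT a|M j. r j a) = 1"
  using has_bochner_integral_nn_integral[of "r j" "M j" 1] nn_integral_r[of j] r_pos
  by (auto simp: has_bochner_integral_iff less_imp_le)

lemma integrable_sqrt_r: "integrable (M j) (\<lambda>a. sqrt (r j a))"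
proof (rule Bochner_Integration.integrable_bound)
  show "integrable (M j) (\<lambda>a. 1 + r j a)" using integrable_r by simp
  show "AE a in M j. norm (sqrt (r j a)) \<le> norm (1 + r j a)"
  proof (rule AE_I2)
    fix a
    have "sqrt (r j a) \<le> sqrt ((1 + r j a)\<^sup>2)"
      using r_pos[of j a] by (intro real_sqrt_le_mono) (simp add: power2_eq_square algebra_simps)
    then show "norm (sqrt (r j a)) \<le> norm (1 + r j a)" using r_pos[of j a] by simp
  qed
qed simp

lemma rho_le_1: "rho j \<le> 1"
proof -
  have "rho j \<le> (LINT a|M j. (1 + r j a) / 2)"
    unfolding rho_def
  proof (rule integral_mono)
    show "integrable (M j) (\<lambda>a. sqrt (r j a))" by (rule integrable_sqrt_r)
    show "integrable (M j) (\<lambda>a. (1 + r j a) / 2)" using integrable_r by simp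
    show "sqrt (r j a) \<le> (1 + r j a) / 2" for a
      using arith_geo_mean_sqrt[of 1 "r j a"] r_pos[of j a] by simp
  qed
  also have "\<dots> = 1" using integrable_r[of j] integral_r[of j] by (simp add: M.prob_space)
  finally show ?thesis .
qed

lemma rho_nonneg: "0 \<le> rho j"
  unfolding rho_def using r_pos by (intro integral_nonneg_AE) (auto simp: less_imp_le)

lemma nn_integral_sqrt_r: "(\<integral>\<^sup>+ a. ennreal (sqrt (r j a)) \<partial>M j) = ennreal (rho j)"
  unfolding rho_def using r_pos integrable_sqrt_r
  by (subst nn_integral_eq_integral) (auto simp: less_imp_le)

lemma nn_integral_lik: "k \<le> m \<Longrightarrow> (\<integral>\<^sup>+ x. ennreal (lik k m x) \<partial>PM) = 1"
  using nn_integral_prod_components[of "\<lambda>j a. ennreal (r j a)" k m] r_pos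
  by (simp add: lik_def prod_ennreal less_imp_le nn_integral_r)

lemma nn_integral_sqrt_lik:
  "k \<le> m \<Longrightarrow> (\<integral>\<^sup>+ x. ennreal (sqrt (lik k m x)) \<partial>PM) = ennreal (\<Prod>j\<in>{k..<m}. rho j)"
  using nn_integral_prod_components[of "\<lambda>j a. ennreal (sqrt (r j a))" k m] r_pos
  by (simp add: lik_def sqrt_prod prod_ennreal less_imp_le nn_integral_sqrt_r rho_nonneg)

lemma integrable_lik: "k \<le> m \<Longrightarrow> integrable PM (lik k m)"
  and integral_lik: "k \<le> m \<Longrightarrow> (LINT x|PM. lik k m x) = 1"
  using has_bochner_integral_nn_integral[of "lik k m" PM 1] nn_integral_lik[of k m] lik_pos
  by (auto simp: has_bochner_integral_iff less_imp_le)

lemma integrable_sqrt_lik: "k \<le> m \<Longrightarrow> integrable PM (\<lambda>x. sqrt (lik k m x))"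
  and integral_sqrt_lik: "k \<le> m \<Longrightarrow> (LINT x|PM. sqrt (lik k m x)) = (\<Prod>j\<in>{k..<m}. rho j)"
  using has_bochner_integral_nn_integral[of "\<lambda>x. sqrt (lik k m x)" PM "\<Prod>j\<in>{k..<m}. rho j"]
    nn_integral_sqrt_lik[of k m] lik_pos[of k m]
  by (auto simp: has_bochner_integral_iff less_imp_le rho_nonneg prod_nonneg)

lemma prod_rho_le_1: "(\<Prod>j\<in>{k..<m}. rho j) \<le> 1"
  by (intro prod_le_1) (auto simp: rho_nonneg rho_le_1)

text \<open>Integrating \<open>abs_diff_one_le_AM_GM\<close> gives (1 - R) / s + s (1 + R) with R
  the product of affinities. The first term is at most s by hypothesis and the second at most 2 s
  since R is at most 1.\<close>

lemma nn_integral_abs_lik_minus_1_le: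
  assumes "k \<le> m" "0 < s" "1 - (\<Prod>j\<in>{k..<m}. rho j) \<le> s\<^sup>2"
  shows "(\<integral>\<^sup>+ x. ennreal \<bar>lik k m x - 1\<bar> \<partial>PM) \<le> ennreal (3 * s)"
proof -
  let ?L = "lik k m" and ?R = "\<Prod>j\<in>{k..<m}. rho j"
  note [simp] = integrable_lik[OF assms(1)] integrable_sqrt_lik[OF assms(1)]
    integral_lik[OF assms(1)] integral_sqrt_lik[OF assms(1)]
  have "(LINT x|PM. \<bar>?L x - 1\<bar>) \<le>
      (LINT x|PM. (?L x + 1 - 2 * sqrt (?L x)) / (2 * s) + s * (?L x + 1 + 2 * sqrt (?L x)) / 2)"
    by (intro integral_mono) (auto intro!: abs_diff_one_le_AM_GM assms less_imp_le[OF lik_pos])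
  also have "\<dots> = (1 + 1 - 2 * ?R) / (2 * s) + s * (1 + 1 + 2 * ?R) / 2"
    by (simp add: P.prob_space)
  also have "\<dots> = (1 - ?R) / s + s * (1 + ?R)" using assms by (simp add: field_simps)
  also have "\<dots> \<le> s + s * 2"
  proof (intro add_mono mult_left_mono)
    show "(1 - ?R) / s \<le> s" using assms by (simp add: divide_le_eq power2_eq_square)
    show "1 + ?R \<le> 2" using prod_rho_le_1[of k m] by simp
  qed (use assms in auto)
  finally have "(LINT x|PM. \<bar>?L x - 1\<bar>) \<le> 3 * s" by simp
  then show ?thesis by (subst nn_integral_eq_integral) (auto simp: ennreal_leI)
qed

text \<open>Jensen's inequality in coordinate n: given the earlier coordinates, \<open>r n\<close>
  has mean 1, so the distance of the product from 1 grows on average. The set \<open>B\<close>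
  stands for an event determined by the first n coordinates, and the inner integral over a spliced
  copy plays the part of the conditional expectation.\<close>

lemma abs_lik_submartingale:
  assumes kn: "k \<le> n" and [measurable]: "B \<in> sets PM"
    and B: "\<And>x y. (\<forall>i<n. x i = y i) \<Longrightarrow> x \<in> space PM \<Longrightarrow> y \<in> space PM \<Longrightarrow> x \<in> B \<Longrightarrow> y \<in> B"
  shows "(\<integral>\<^sup>+ x. ennreal \<bar>lik k n x - 1\<bar> * indicator B x \<partial>PM)
       \<le> (\<integral>\<^sup>+ x. ennreal \<bar>lik k (Suc n) x - 1\<bar> * indicator B x \<partial>PM)"
proof -
  have "(\<integral>\<^sup>+ x. ennreal \<bar>lik k n x - 1\<bar> * indicator B x \<partial>PM)
     \<le> (\<integral>\<^sup>+ x. \<integral>\<^sup>+ y. ennreal \<bar>lik k n x * r n (y n) - 1\<bar> * indicator B x \<partial>PM \<partial>PM)"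
  proof (rule nn_integral_mono)
    fix x
    let ?c = "lik k n x"
    have int: "integrable PM (\<lambda>y. r n (y n))" and 1: "(LINT y|PM. r n (y n)) = 1"
      using integrable_lik[of n "Suc n"] integral_lik[of n "Suc n"] by (simp_all add: lik_def[abs_def])
    have "\<bar>?c - 1\<bar> = \<bar>LINT y|PM. ?c * r n (y n) - 1\<bar>"
      using int 1 by (simp add: P.prob_space)
    also have "\<dots> \<le> (LINT y|PM. \<bar>?c * r n (y n) - 1\<bar>)"
      by (rule integral_abs_bound)
    finally have "ennreal \<bar>?c - 1\<bar> \<le> (\<integral>\<^sup>+ y. ennreal \<bar>?c * r n (y n) - 1\<bar> \<partial>PM)"
      using int by (subst nn_integral_eq_integral) (auto intro: ennreal_leI)
    then show "ennreal \<bar>?c - 1\<bar> * indicator B x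
        \<le> (\<integral>\<^sup>+ y. ennreal \<bar>?c * r n (y n) - 1\<bar> * indicator B x \<partial>PM)"
      by (subst nn_integral_multc) (auto intro: mult_right_mono)
  qed
  also have "\<dots> = (\<integral>\<^sup>+ x. \<integral>\<^sup>+ y. ennreal \<bar>lik k (Suc n) (splice_at n (x, y)) - 1\<bar>
      * indicator B (splice_at n (x, y)) \<partial>PM \<partial>PM)"
  proof (intro nn_integral_cong)
    fix x y assume xy: "x \<in> space PM" "y \<in> space PM"
    have s: "splice_at n (x, y) \<in> space PM" using xy by (rule splice_at_in_space)
    have "splice_at n (x, y) \<in> B \<longleftrightarrow> x \<in> B"
      using B[of x "splice_at n (x, y)"] B[of "splice_at n (x, y)" x] xy s by (auto simp: splice_at_def)
    moreover have "lik k (Suc n) (splice_at n (x, y)) = lik k n x * r n (y n)"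
      using kn by (simp add: lik_Suc) (auto simp: splice_at_def intro: lik_cong)
    ultimately show "ennreal \<bar>lik k n x * r n (y n) - 1\<bar> * indicator B x
      = ennreal \<bar>lik k (Suc n) (splice_at n (x, y)) - 1\<bar> * indicator B (splice_at n (x, y))"
      by (simp add: indicator_def)
  qed
  also have "\<dots> = (\<integral>\<^sup>+ x. ennreal \<bar>lik k (Suc n) x - 1\<bar> * indicator B x \<partial>PM)"
    by (rule nn_integral_splice_at[symmetric]) simp
  finally show ?thesis .
qed

text \<open>The maximal inequality on the window from k to n has a bound free of n, because the
  hypothesis on the affinities is uniform in n. The windows then increase to the whole
  event.\<close>

lemma emeasure_lik_far_from_1:
  assumes "0 < e" "0 < s" and R: "\<And>n. k \<le> n \<Longrightarrow> 1 - (\<Prod>j\<in>{k..<n}. rho j) \<le> s\<^sup>2"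
  shows "emeasure PM {x\<in>space PM. \<exists>i\<ge>k. e < \<bar>lik k i x - 1\<bar>} \<le> ennreal (3 * s / e)"
proof -
  define C where "C n = {x\<in>space PM. \<exists>i\<in>{k..n}. ennreal e < ennreal \<bar>lik k i x - 1\<bar>}" for n
  have [measurable]: "C n \<in> sets PM" for n unfolding C_def by measurable
  have bound: "emeasure PM (C n) \<le> ennreal (3 * s / e)" if "k \<le> n" for n
  proof -
    have "ennreal e * emeasure PM (C n) \<le>
      (\<integral>\<^sup>+ x. ennreal \<bar>lik k n x - 1\<bar> * indicator (C n) x \<partial>PM)"
      unfolding C_def
    proof (rule submartingale_maximal_inequality)
      show "(\<integral>\<^sup>+ x. ennreal \<bar>lik k n x - 1\<bar> *
            indicator {x \<in> space PM. \<exists>i\<in>{k..n}. ennreal e < ennreal \<bar>lik k i x - 1\<bar>} x \<partial>PM)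
         \<le> (\<integral>\<^sup>+ x. ennreal \<bar>lik k (Suc n) x - 1\<bar> *
            indicator {x \<in> space PM. \<exists>i\<in>{k..n}. ennreal e < ennreal \<bar>lik k i x - 1\<bar>} x \<partial>PM)"
        if "k \<le> n" for n
      proof (rule abs_lik_submartingale[OF that])
        fix x y :: "nat \<Rightarrow> 'b" assume eq: "\<forall>i<n. x i = y i" and y: "y \<in> space PM"
          and x: "x \<in> {x \<in> space PM. \<exists>i\<in>{k..n}. ennreal e < ennreal \<bar>lik k i x - 1\<bar>}"
        have "lik k i x = lik k i y" if "i \<le> n" for i
          using eq that by (intro lik_cong) auto
        then show "y \<in> {x \<in> space PM. \<exists>i\<in>{k..n}. ennreal e < ennreal \<bar>lik k i x - 1\<bar>}"
          using x y by auto
      qed measurable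
    qed (use that in auto)
    also have "\<dots> \<le> (\<integral>\<^sup>+ x. ennreal \<bar>lik k n x - 1\<bar> \<partial>PM)"
      by (rule nn_integral_mono) (auto simp: indicator_def)
    also have "\<dots> \<le> ennreal (3 * s)"
      by (rule nn_integral_abs_lik_minus_1_le) (use that R assms in auto)
    finally have "ennreal (1 / e) * (ennreal e * emeasure PM (C n)) \<le> ennreal (1 / e) * ennreal (3 * s)"
      by (rule mult_left_mono) simp
    moreover have "ennreal (1 / e) * ennreal e = 1"
      using assms by (simp flip: ennreal_mult'')
    moreover have "ennreal (1 / e) * ennreal (3 * s) = ennreal (3 * s / e)"
      using assms by (simp flip: ennreal_mult'')
    ultimately show ?thesis by (simp flip: mult.assoc)
  qed
  have "{x\<in>space PM. \<exists>i\<ge>k. e < \<bar>lik k i x - 1\<bar>} = (\<Union>n. C (k + n))"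
  proof (intro equalityI subsetI)
    fix x assume "x \<in> {x\<in>space PM. \<exists>i\<ge>k. e < \<bar>lik k i x - 1\<bar>}"
    then obtain i where "x \<in> space PM" "k \<le> i" "e < \<bar>lik k i x - 1\<bar>" by blast
    then have "x \<in> C (k + (i - k))"
      using assms(1) by (auto simp: C_def ennreal_less_iff intro!: bexI[of _ i])
    then show "x \<in> (\<Union>n. C (k + n))" by blast
  qed (use assms(1) in \<open>auto simp: C_def ennreal_less_iff\<close>)
  also have "emeasure PM \<dots> = (SUP n. emeasure PM (C (k + n)))"
    by (rule SUP_emeasure_incseq[symmetric]) (auto simp: incseq_def C_def)
  also have "\<dots> \<le> ennreal (3 * s / e)" by (intro SUP_least bound) simp
  finally show ?thesis .
qed

lemma prod_rho_ge:
  assumes "summable (\<lambda>j. 1 - rho j)"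
  shows "1 - (\<Prod>j\<in>{k..<n}. rho j) \<le> (\<Sum>j. 1 - rho (j + k))"
proof (cases "k \<le> n")
  case True
  have "1 - (\<Sum>j\<in>{k..<n}. 1 - rho j) \<le> (\<Prod>j\<in>{k..<n}. 1 - (1 - rho j))"
    by (rule Weierstrass_prod_ineq) (auto simp: rho_nonneg rho_le_1)
  then have "1 - (\<Prod>j\<in>{k..<n}. rho j) \<le> (\<Sum>j\<in>{k..<n}. 1 - rho j)" by simp
  also have "\<dots> = (\<Sum>j<n - k. 1 - rho (j + k))"
    using sum.shift_bounds_nat_ivl[of "\<lambda>j. 1 - rho j" 0 k "n - k"] True by (simp add: lessThan_atLeast0)
  also have "\<dots> \<le> (\<Sum>j. 1 - rho (j + k))"
    using assms rho_le_1 by (intro sum_le_suminf) (auto simp: summable_iff_shift[of "\<lambda>j. 1 - rho j"])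
  finally show ?thesis .
next
  case False
  then show ?thesis using assms rho_le_1
    by (auto intro!: suminf_nonneg simp: summable_iff_shift[of "\<lambda>j. 1 - rho j"])
qed

text \<open>Weierstrass' product inequality bounds the defect of the product by a tail of the
  series. The lower bound \<open>k0\<close> on k allows the tail to start beyond the coordinates of
  a given cylinder.\<close>

lemma tail_rho_small:
  assumes "summable (\<lambda>j. 1 - rho j)" "0 < s"
  obtains k where "k0 \<le> k" "\<And>n. 1 - (\<Prod>j\<in>{k..<n}. rho j) \<le> s\<^sup>2"
proof -
  have "(\<lambda>k. \<Sum>j. 1 - rho (j + k)) \<longlonglongrightarrow> 0" by (rule suminf_exist_split2[OF assms(1)])
  then have "eventually (\<lambda>k. (\<Sum>j. 1 - rho (j + k)) < s\<^sup>2) sequentially"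
    using assms(2) by (intro order_tendstoD) auto
  then have "eventually (\<lambda>k. k0 \<le> k \<and> (\<Sum>j. 1 - rho (j + k)) < s\<^sup>2) sequentially"
    by (rule eventually_conj[OF eventually_ge_at_top])
  then obtain k where "k0 \<le> k" "(\<Sum>j. 1 - rho (j + k)) < s\<^sup>2"
    using eventually_happens sequentially_bot by blast
  then show thesis using that[of k] prod_rho_ge[OF assms(1), of k] by (meson less_imp_le order_trans)
qed

text \<open>For each tolerance, the points at which every tail leaves the band around 1 form a null
  set. Countably many tolerances suffice, and on the remaining points
  \<open>partial_products_converge_pos\<close> applies.\<close>

theorem AE_lik_converges_pos:
  assumes sm: "summable (\<lambda>j. 1 - rho j)"
  shows "AE x in PM. \<exists>l>0. (\<lambda>n. \<Prod>j<n. r j (x j)) \<longlonglongrightarrow> l"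
proof -
  have "AE x in PM. \<exists>k. \<forall>m\<ge>k. \<bar>lik k m x - 1\<bar> \<le> 1 / real (Suc n)" for n
  proof -
    define e where "e = 1 / real (Suc n)"
    have e: "0 < e" by (simp add: e_def)
    let ?N = "{x\<in>space PM. \<forall>k. \<exists>i\<ge>k. e < \<bar>lik k i x - 1\<bar>}"
    have le: "emeasure PM ?N \<le> ennreal d" if "0 < d" for d
    proof -
      \<comment> \<open>This is the value of s for which the bound 3 s / e equals d.\<close>
      have "0 < d * e / 3" using that e by simp
      then obtain k where k: "\<And>n. 1 - (\<Prod>j\<in>{k..<n}. rho j) \<le> (d * e / 3)\<^sup>2"
        using tail_rho_small[OF sm] by blast
      have "emeasure PM ?N \<le> emeasure PM {x\<in>space PM. \<exists>i\<ge>k. e < \<bar>lik k i x - 1\<bar>}"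
        by (rule emeasure_mono) auto
      also have "\<dots> \<le> ennreal (3 * (d * e / 3) / e)"
        by (rule emeasure_lik_far_from_1) (use e that k in auto)
      finally show ?thesis using e by simp
    qed
    have "emeasure PM ?N \<le> 0"
    proof (rule ennreal_le_epsilon)
      show "emeasure PM ?N \<le> 0 + ennreal d" if "0 < d" for d
        using le[OF that] by (simp only: add_0)
    qed
    then have "emeasure PM ?N = 0" by (simp only: le_zero_eq)
    then have "AE x in PM. \<not> (\<forall>k. \<exists>i\<ge>k. e < \<bar>lik k i x - 1\<bar>)"
      by (intro AE_I[of _ _ ?N]) auto
    then show ?thesis by (auto simp: not_less e_def elim!: eventually_mono)
  qed
  then have "AE x in PM. \<forall>n. \<exists>k. \<forall>m\<ge>k. \<bar>lik k m x - 1\<bar> \<le> 1 / real (Suc n)"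
    by (simp add: AE_all_countable)
  then show ?thesis
  proof eventually_elim
    case (elim x)
    show ?case
      by (rule partial_products_converge_pos) (use elim r_pos in \<open>auto simp: lik_def\<close>)
  qed
qed

end

section \<open>Absolute continuity and singularity of the two product measures\<close>

context kakutani
begin

lemma sequence_prob_space_QM: "sequence_prob_space (\<lambda>j. density (M j) (\<lambda>a. ennreal (r j a)))"
  by (intro sequence_prob_spaceI prob_spaceI) (simp add: emeasure_density nn_integral_r cong: nn_integral_cong)

lemma sets_QM: "sets QM = sets PM"
  by (rule sets_PiM_cong) auto

lemma nn_integral_lik_cylinder:
  assumes J: "J \<subseteq> {..<n}" and F: "\<And>j. j \<in> J \<Longrightarrow> F j \<in> sets (M j)"
  shows "(\<integral>\<^sup>+ x. ennreal (lik 0 n x) * indicator (prod_emb UNIV M J (Pi\<^sub>E J F)) x \<partial>PM)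
    = (\<Prod>j\<in>J. emeasure (density (M j) (\<lambda>a. ennreal (r j a))) (F j))"
proof -
  \<comment> \<open>Padding with the whole space turns the indicator of the cylinder into a product
    over all coordinates below n; the padded coordinates integrate to 1.\<close>
  define G where "G j = (if j \<in> J then F j else space (M j))" for j
  define \<phi> where "\<phi> j a = ennreal (r j a) * indicator (G j) a" for j a
  have G [measurable]: "G j \<in> sets (M j)" for j using F by (auto simp: G_def)
  have fin: "finite J" using J finite_subset by blast
  have "(\<integral>\<^sup>+ x. ennreal (lik 0 n x) * indicator (prod_emb UNIV M J (Pi\<^sub>E J F)) x \<partial>PM)
    = (\<integral>\<^sup>+ x. (\<Prod>j\<in>{0..<n}. \<phi> j (x j)) \<partial>PM)"
  proof (rule nn_integral_cong)
    fix x assume x: "x \<in> space PM"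
    have "x \<in> prod_emb UNIV M J (Pi\<^sub>E J F) \<longleftrightarrow> (\<forall>j\<in>{0..<n}. x j \<in> G j)"
      using x J by (auto simp: prod_emb_def space_PiM PiE_iff G_def extensional_def)
    then have "indicator (prod_emb UNIV M J (Pi\<^sub>E J F)) x = (\<Prod>j\<in>{0..<n}. indicator (G j) (x j) :: ennreal)"
      by (auto simp: indicator_def prod_zero_iff)
    then show "ennreal (lik 0 n x) * indicator (prod_emb UNIV M J (Pi\<^sub>E J F)) x = (\<Prod>j\<in>{0..<n}. \<phi> j (x j))"
      using r_pos by (simp add: \<phi>_def lik_def prod.distrib prod_ennreal less_imp_le)
  qed
  also have "\<dots> = (\<Prod>j\<in>{0..<n}. \<integral>\<^sup>+ a. \<phi> j a \<partial>M j)"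
    by (rule nn_integral_prod_components) (auto simp: \<phi>_def)
  also have "\<dots> = (\<Prod>j\<in>J. \<integral>\<^sup>+ a. \<phi> j a \<partial>M j)"
  proof (rule prod.mono_neutral_right)
    show "\<forall>i\<in>{0..<n} - J. (\<integral>\<^sup>+ a. \<phi> i a \<partial>M i) = 1"
      by (auto simp: \<phi>_def G_def nn_integral_r cong: nn_integral_cong)
  qed (use J in auto)
  also have "\<dots> = (\<Prod>j\<in>J. emeasure (density (M j) (\<lambda>a. ennreal (r j a))) (F j))"
    by (rule prod.cong) (auto simp: \<phi>_def G_def emeasure_density F)
  finally show ?thesis .
qed

text \<open>On a cylinder, the integral of \<open>lik 0 n\<close> is eventually the constant
  \<open>?q\<close>. Fatou's lemma gives one inequality between \<open>?q\<close> and the integral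
  of \<open>l\<close>. The other needs that no mass escapes, which comes from the L1 distance
  between \<open>lik 0 k\<close> and \<open>l\<close>.\<close>

theorem QM_eq_density:
  assumes sm: "summable (\<lambda>j. 1 - rho j)"
    and [measurable]: "l \<in> borel_measurable PM"
    and l: "AE x in PM. (\<lambda>n. \<Prod>j<n. r j (x j)) \<longlonglongrightarrow> l x"
  shows "QM = density PM (\<lambda>x. ennreal (l x))"
proof -
  interpret Q: sequence_prob_space "\<lambda>j. density (M j) (\<lambda>a. ennreal (r j a))"
    by (rule sequence_prob_space_QM)
  have conv: "AE x in PM. (\<lambda>n. lik 0 n x) \<longlonglongrightarrow> l x \<and> 0 \<le> l x"
    using l
  proof eventually_elim
    case (elim x)
    then have "(\<lambda>n. lik 0 n x) \<longlonglongrightarrow> l x" by (simp add: lik_def lessThan_atLeast0)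
    then show ?case
      by (intro conjI LIMSEQ_le_const[where a = 0]) (auto intro: less_imp_le[OF lik_pos])
  qed
  have "density PM (\<lambda>x. ennreal (l x)) = QM"
  proof (rule Q.PiM_eq)
    show "sets (density PM (\<lambda>x. ennreal (l x))) = sets QM" by (simp add: sets_QM)
    fix J :: "nat set" and F
    assume J: "finite J" and F': "\<And>j. j \<in> J \<Longrightarrow> F j \<in> sets (density (M j) (\<lambda>a. ennreal (r j a)))"
    then have F: "\<And>j. j \<in> J \<Longrightarrow> F j \<in> sets (M j)" by simp
    let ?E = "prod_emb UNIV M J (Pi\<^sub>E J F)"
    let ?q = "\<Prod>j\<in>J. emeasure (density (M j) (\<lambda>a. ennreal (r j a))) (F j)"
    have emb: "prod_emb UNIV (\<lambda>j. density (M j) (\<lambda>a. ennreal (r j a))) J (Pi\<^sub>E J F) = ?E"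
      by (simp add: prod_emb_def)
    have E [measurable]: "?E \<in> sets PM" using J F by (intro sets_PiM_I) auto
    obtain k0 where k0: "J \<subseteq> {..<k0}" using J finite_nat_bounded by blast
    have cyl: "(\<integral>\<^sup>+ x. ennreal (lik 0 n x) * indicator ?E x \<partial>PM) = ?q" if "k0 \<le> n" for n
      by (rule nn_integral_lik_cylinder) (use k0 that F in auto)
    have "(\<integral>\<^sup>+ x. ennreal (l x) * indicator ?E x \<partial>PM)
      = (\<integral>\<^sup>+ x. liminf (\<lambda>n. ennreal (lik 0 n x) * indicator ?E x) \<partial>PM)"
    proof (rule nn_integral_cong_AE, use conv in eventually_elim)
      case (elim x)
      have "(\<lambda>n. ennreal (lik 0 n x) * indicator ?E x) \<longlonglongrightarrow> ennreal (l x) * indicator ?E x"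
        using elim by (cases "x \<in> ?E") auto
      then show ?case by (intro lim_imp_Liminf[symmetric]) auto
    qed
    also have "\<dots> \<le> liminf (\<lambda>n. \<integral>\<^sup>+ x. ennreal (lik 0 n x) * indicator ?E x \<partial>PM)"
      by (rule nn_integral_liminf) measurable
    also have "\<dots> = ?q"
      by (intro lim_imp_Liminf tendsto_eventually) (auto simp: eventually_sequentially intro!: exI[of _ k0] cyl)
    finally have upper: "(\<integral>\<^sup>+ x. ennreal (l x) * indicator ?E x \<partial>PM) \<le> ?q" .
    have lower: "?q \<le> (\<integral>\<^sup>+ x. ennreal (l x) * indicator ?E x \<partial>PM) + ennreal d" if "0 < d" for d
    proof -
      have "0 < d / 3" using that by simp
      then obtain k where k: "k0 \<le> k" "\<And>n. 1 - (\<Prod>j\<in>{k..<n}. rho j) \<le> (d / 3)\<^sup>2"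
        using tail_rho_small[OF sm, of "d / 3" k0 thesis] by blast
      have near: "(\<integral>\<^sup>+ x. ennreal \<bar>lik 0 n x - lik 0 k x\<bar> \<partial>PM) \<le> ennreal d" if n: "k \<le> n" for n
      proof -
        have "(\<integral>\<^sup>+ x. ennreal \<bar>lik 0 n x - lik 0 k x\<bar> \<partial>PM)
          = (\<integral>\<^sup>+ x. ennreal (lik 0 k x) * ennreal \<bar>lik k n x - 1\<bar> \<partial>PM)"
        proof (rule nn_integral_cong)
          fix x
          have "lik 0 n x - lik 0 k x = lik 0 k x * (lik k n x - 1)"
            using lik_mult[of 0 k n x] n by (simp add: algebra_simps)
          then show "ennreal \<bar>lik 0 n x - lik 0 k x\<bar> = ennreal (lik 0 k x) * ennreal \<bar>lik k n x - 1\<bar>"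
            using lik_pos[of 0 k x] by (simp add: abs_mult ennreal_mult)
        qed
        \<comment> \<open>The blocks before and after k are independent and the first has mean 1, so
          the distance depends on the tail alone and its bound is uniform in n. This uniformity lets
          Fatou's lemma carry it over to \<open>l\<close>.\<close>
        also have "\<dots> = (\<integral>\<^sup>+ x. ennreal (lik 0 k x) \<partial>PM) * (\<integral>\<^sup>+ x. ennreal \<bar>lik k n x - 1\<bar> \<partial>PM)"
        proof (rule nn_integral_mult_indep[where n = k])
          show "ennreal (lik 0 k x) = ennreal (lik 0 k y)" if "\<forall>i<k. x i = y i" for x y
            using that by (intro arg_cong[where f = ennreal] lik_cong) auto
          show "ennreal \<bar>lik k n x - 1\<bar> = ennreal \<bar>lik k n y - 1\<bar>" if "\<forall>i\<ge>k. x i = y i" for x y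
          proof -
            have "lik k n x = lik k n y" unfolding lik_def using that by (intro prod.cong) auto
            then show ?thesis by simp
          qed
        qed measurable
        also have "\<dots> \<le> ennreal (3 * (d / 3))"
          using nn_integral_abs_lik_minus_1_le[OF n, of "d / 3"] k(2)[of n] \<open>0 < d\<close> by (simp add: nn_integral_lik)
        finally show ?thesis by simp
      qed
      have "(\<integral>\<^sup>+ x. ennreal \<bar>l x - lik 0 k x\<bar> \<partial>PM) = (\<integral>\<^sup>+ x. liminf (\<lambda>n. ennreal \<bar>lik 0 n x - lik 0 k x\<bar>) \<partial>PM)"
      proof (rule nn_integral_cong_AE, use conv in eventually_elim)
        case (elim x)
        have "(\<lambda>n. ennreal \<bar>lik 0 n x - lik 0 k x\<bar>) \<longlonglongrightarrow> ennreal \<bar>l x - lik 0 k x\<bar>"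
          using elim by (intro tendsto_intros) auto
        then show ?case by (intro lim_imp_Liminf[symmetric]) auto
      qed
      also have "\<dots> \<le> liminf (\<lambda>n. \<integral>\<^sup>+ x. ennreal \<bar>lik 0 n x - lik 0 k x\<bar> \<partial>PM)"
        by (rule nn_integral_liminf) measurable
      also have "\<dots> \<le> limsup (\<lambda>n. \<integral>\<^sup>+ x. ennreal \<bar>lik 0 n x - lik 0 k x\<bar> \<partial>PM)"
        by (rule Liminf_le_Limsup) simp
      also have "\<dots> \<le> ennreal d"
        by (rule Limsup_bounded) (auto simp: eventually_sequentially intro!: exI[of _ k] near)
      finally have dist: "(\<integral>\<^sup>+ x. ennreal \<bar>l x - lik 0 k x\<bar> \<partial>PM) \<le> ennreal d" .
      have "?q = (\<integral>\<^sup>+ x. ennreal (lik 0 k x) * indicator ?E x \<partial>PM)" using cyl k(1) by simp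
      also have "\<dots> \<le> (\<integral>\<^sup>+ x. ennreal (l x) * indicator ?E x + ennreal \<bar>l x - lik 0 k x\<bar> \<partial>PM)"
      proof (rule nn_integral_mono_AE, use conv in eventually_elim)
        case (elim x)
        have "ennreal (lik 0 k x) \<le> ennreal (l x) + ennreal \<bar>l x - lik 0 k x\<bar>"
          using elim by (subst ennreal_plus[symmetric]) (auto simp del: ennreal_plus intro!: ennreal_leI)
        then show ?case by (auto simp: indicator_def)
      qed
      also have "\<dots> = (\<integral>\<^sup>+ x. ennreal (l x) * indicator ?E x \<partial>PM) + (\<integral>\<^sup>+ x. ennreal \<bar>l x - lik 0 k x\<bar> \<partial>PM)"
        by (rule nn_integral_add) auto
      also have "\<dots> \<le> (\<integral>\<^sup>+ x. ennreal (l x) * indicator ?E x \<partial>PM) + ennreal d"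
        by (intro add_left_mono dist)
      finally show ?thesis .
    qed
    have "(\<integral>\<^sup>+ x. ennreal (l x) * indicator ?E x \<partial>PM) = ?q"
      by (rule antisym[OF upper ennreal_le_epsilon]) (rule lower)
    then show "emeasure (density PM (\<lambda>x. ennreal (l x)))
        (prod_emb UNIV (\<lambda>j. density (M j) (\<lambda>a. ennreal (r j a))) J (Pi\<^sub>E J F)) = ?q"
      unfolding emb by (simp add: emeasure_density)
  qed
  then show ?thesis by simp
qed

text \<open>From \<open>rho j \<le> exp (rho j - 1)\<close>, the product is at most the exponential
  of minus the partial sums, which tend to infinity.\<close>

lemma prod_rho_tendsto_0:
  assumes "\<not> summable (\<lambda>j. 1 - rho j)"
  shows "(\<lambda>n. \<Prod>j\<in>{0..<n}. rho j) \<longlonglongrightarrow> 0"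
proof (rule tendsto_sandwich[where f = "\<lambda>_. 0" and h = "\<lambda>n. exp (- (\<Sum>j<n. 1 - rho j))"])
  let ?S = "\<lambda>n. \<Sum>j<n. 1 - rho j"
  have "filterlim ?S at_top sequentially"
    unfolding filterlim_at_top
  proof
    fix Z
    have "\<not> (\<forall>n. (\<Sum>j\<le>n. 1 - rho j) \<le> Z)"
      using assms rho_le_1 bounded_imp_summable[of "\<lambda>j. 1 - rho j" Z] by auto
    then obtain n where n: "Z < (\<Sum>j\<le>n. 1 - rho j)" by (auto simp: not_le)
    have "Z \<le> ?S m" if "Suc n \<le> m" for m
    proof -
      have "(\<Sum>j\<le>n. 1 - rho j) \<le> ?S m" using that rho_le_1 by (intro sum_mono2) auto
      then show ?thesis using n by simp
    qed
    then show "\<forall>\<^sub>F m in sequentially. Z \<le> ?S m" by (auto simp: eventually_sequentially)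
  qed
  then have "((\<lambda>n. exp (- ?S n)) \<longlongrightarrow> 0) sequentially"
    by (intro filterlim_compose[OF exp_at_bot] filterlim_compose[OF filterlim_uminus_at_bot_at_top])
  then show "(\<lambda>n. exp (- ?S n)) \<longlonglongrightarrow> 0" .
  show "\<forall>\<^sub>F n in sequentially. (\<Prod>j\<in>{0..<n}. rho j) \<le> exp (- ?S n)"
  proof (intro always_eventually allI)
    fix n
    have "(\<Prod>j\<in>{0..<n}. rho j) \<le> (\<Prod>j\<in>{0..<n}. exp (rho j - 1))"
      using exp_ge_add_one_self[of "rho _ - 1"] by (intro prod_mono) (auto simp: rho_nonneg)
    also have "\<dots> = exp (- ?S n)" by (simp add: exp_sum[symmetric] sum_negf[symmetric] lessThan_atLeast0)
    finally show "(\<Prod>j\<in>{0..<n}. rho j) \<le> exp (- ?S n)" .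
  qed
qed (auto intro!: always_eventually prod_nonneg rho_nonneg)

text \<open>Multiplication by a factor of mean \<open>rho n \<le> 1\<close> makes the square roots a
  supermartingale. The maximal inequality started at time k bounds all later excesses at once by the
  mean at time k, which vanishes as k grows; this gives convergence almost surely and not only in
  measure.\<close>

theorem AE_lik_tendsto_0:
  assumes "\<not> summable (\<lambda>j. 1 - rho j)"
  shows "AE x in PM. (\<lambda>n. \<Prod>j<n. r j (x j)) \<longlonglongrightarrow> 0"
proof -
  define X where "X n x = ennreal (sqrt (lik 0 n x))" for n x
  have [measurable]: "X n \<in> borel_measurable PM" for n unfolding X_def by measurable
  have X_cong: "X i x = X i y" if "\<forall>j<n. x j = y j" "i \<le> n" for i n x y
    unfolding X_def using that lik_cong[of i x y 0] by auto
  have step: "(\<integral>\<^sup>+ x. X (Suc n) x * indicator {x\<in>space PM. \<forall>i\<in>{k..n}. X i x \<le> e} x \<partial>PM) \<le>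
      (\<integral>\<^sup>+ x. X n x * indicator {x\<in>space PM. \<forall>i\<in>{k..n}. X i x \<le> e} x \<partial>PM)" for k n e
  proof -
    let ?u = "\<lambda>x. X n x * indicator {x\<in>space PM. \<forall>i\<in>{k..n}. X i x \<le> e} x"
    have "(\<integral>\<^sup>+ x. X (Suc n) x * indicator {x\<in>space PM. \<forall>i\<in>{k..n}. X i x \<le> e} x \<partial>PM)
      = (\<integral>\<^sup>+ x. ?u x * ennreal (sqrt (r n (x n))) \<partial>PM)"
      using lik_pos r_pos
      by (intro nn_integral_cong) (simp add: X_def lik_Suc real_sqrt_mult ennreal_mult less_imp_le mult_ac)
    also have "\<dots> = (\<integral>\<^sup>+ x. ?u x \<partial>PM) * (\<integral>\<^sup>+ x. ennreal (sqrt (r n (x n))) \<partial>PM)"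
    proof (rule nn_integral_mult_indep[where n = n])
      show "?u x = ?u y" if "x \<in> space PM" "y \<in> space PM" "\<forall>i<n. x i = y i" for x y
        using that X_cong[OF that(3)] by (auto simp: indicator_def)
    qed auto
    also have "(\<integral>\<^sup>+ x. ennreal (sqrt (r n (x n))) \<partial>PM) = ennreal (rho n)"
      using nn_integral_component[of "\<lambda>a. ennreal (sqrt (r n a))" n] by (simp add: nn_integral_sqrt_r)
    also have "(\<integral>\<^sup>+ x. ?u x \<partial>PM) * ennreal (rho n) \<le> (\<integral>\<^sup>+ x. ?u x \<partial>PM) * 1"
      using rho_le_1[of n] by (intro mult_left_mono) (auto simp: ennreal_le_1)
    finally show ?thesis by simp
  qed
  have "AE x in PM. \<exists>k. \<forall>i\<ge>k. X i x \<le> ennreal (1 / Suc n)" for n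
  proof -
    define e where "e = 1 / real (Suc n)"
    have e: "0 < e" by (simp add: e_def)
    \<comment> \<open>The event of infinitely many excesses; it lies in the event of some excess
      after k for every k, so each k gives a bound on its measure.\<close>
    define N where "N = {x\<in>space PM. \<forall>k. \<exists>i\<ge>k. ennreal e < X i x}"
    have [measurable]: "N \<in> sets PM" unfolding N_def by measurable
    have "ennreal e * emeasure PM N \<le> ennreal (\<Prod>j\<in>{0..<k}. rho j)" for k
    proof -
      define D where "D m = {x\<in>space PM. \<exists>i\<in>{k..m}. ennreal e < X i x}" for m
      have [measurable]: "D m \<in> sets PM" for m unfolding D_def by measurable
      have "ennreal e * emeasure PM (D (k + m)) \<le> ennreal (\<Prod>j\<in>{0..<k}. rho j)" for m
      proof -
        have "ennreal e * emeasure PM (D (k + m)) \<le> (\<integral>\<^sup>+ x. X k x \<partial>PM)"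
          unfolding D_def by (rule supermartingale_maximal_inequality) (auto intro: step)
        then show ?thesis unfolding X_def by (simp add: nn_integral_sqrt_lik)
      qed
      moreover have "ennreal e * emeasure PM (\<Union>m. D (k + m)) = (SUP m. ennreal e * emeasure PM (D (k + m)))"
        by (subst SUP_emeasure_incseq[symmetric]) (auto simp: incseq_def D_def SUP_mult_left_ennreal)
      ultimately have "ennreal e * emeasure PM (\<Union>m. D (k + m)) \<le> ennreal (\<Prod>j\<in>{0..<k}. rho j)"
        by (simp add: SUP_least)
      moreover have "N \<subseteq> (\<Union>m. D (k + m))"
      proof
        fix x assume "x \<in> N"
        then obtain i where "k \<le> i" "ennreal e < X i x" "x \<in> space PM" by (auto simp: N_def)
        then have "x \<in> D (k + (i - k))" by (auto simp: D_def)
        then show "x \<in> (\<Union>m. D (k + m))" by blast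
      qed
      then have "ennreal e * emeasure PM N \<le> ennreal e * emeasure PM (\<Union>m. D (k + m))"
        by (intro mult_left_mono emeasure_mono) auto
      ultimately show ?thesis by order
    qed
    moreover have "(\<lambda>k. ennreal (\<Prod>j\<in>{0..<k}. rho j)) \<longlonglongrightarrow> ennreal 0"
      by (intro tendsto_ennrealI prod_rho_tendsto_0 assms)
    ultimately have "ennreal e * emeasure PM N \<le> ennreal 0"
      by (intro LIMSEQ_le_const) auto
    then have "emeasure PM N = 0" using e by simp
    then have "AE x in PM. x \<notin> N" by (intro AE_not_in) (auto simp: null_sets_def)
    then have "AE x in PM. \<exists>k. \<forall>i\<ge>k. X i x \<le> ennreal e"
      using AE_space by eventually_elim (auto simp: N_def not_less)
    then show ?thesis by (simp add: e_def)
  qed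
  then have "AE x in PM. \<forall>n. \<exists>k. \<forall>i\<ge>k. X i x \<le> ennreal (1 / Suc n)"
    by (simp add: AE_all_countable)
  then show ?thesis
  proof eventually_elim
    case (elim x)
    have "(\<lambda>n. sqrt (lik 0 n x)) \<longlonglongrightarrow> 0"
    proof (rule LIMSEQ_I)
      fix e :: real assume "0 < e"
      then obtain n where n: "1 / real (Suc n) < e" using nat_approx_posE by blast
      obtain k where k: "\<And>i. k \<le> i \<Longrightarrow> X i x \<le> ennreal (1 / Suc n)" using elim by blast
      have "norm (sqrt (lik 0 i x) - 0) < e" if "k \<le> i" for i
      proof -
        have "sqrt (lik 0 i x) \<le> 1 / Suc n" using k[OF that] by (simp add: X_def)
        then show ?thesis using n lik_pos[of 0 i x] by simp
      qed
      then show "\<exists>no. \<forall>n\<ge>no. norm (sqrt (lik 0 n x) - 0) < e" by blast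
    qed
    then have "(\<lambda>n. (sqrt (lik 0 n x))\<^sup>2) \<longlonglongrightarrow> 0\<^sup>2" by (rule tendsto_power)
    then show ?case using lik_pos[of 0 _ x] by (simp add: less_imp_le) (simp add: lik_def lessThan_atLeast0)
  qed
qed

text \<open>The affinity is symmetric: under the density \<open>r j\<close>, the inverse root of
  \<open>r j\<close> again has mean \<open>rho j\<close>. Thus the inverse roots of the likelihood
  ratios have lower limit 0 almost surely, whereas ratios tending to 0 would keep them eventually
  above 1.\<close>

theorem AE_QM_not_lik_tendsto_0:
  assumes "\<not> summable (\<lambda>j. 1 - rho j)"
  shows "AE x in QM. \<not> (\<lambda>n. \<Prod>j<n. r j (x j)) \<longlonglongrightarrow> 0"
proof -
  interpret Q: sequence_prob_space "\<lambda>j. density (M j) (\<lambda>a. ennreal (r j a))"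
    by (rule sequence_prob_space_QM)
  define Y where "Y n x = (\<Prod>j\<in>{0..<n}. ennreal (1 / sqrt (r j (x j))))" for n x
  have [measurable]: "Y n \<in> borel_measurable QM" for n
    unfolding Y_def by measurable
  have one: "(\<integral>\<^sup>+ a. ennreal (1 / sqrt (r j a)) \<partial>density (M j) (\<lambda>a. ennreal (r j a))) = ennreal (rho j)" for j
  proof -
    have "r j a / sqrt (r j a) = sqrt (r j a)" for a
      using r_pos[of j a] by (simp add: real_div_sqrt)
    then show ?thesis using r_pos
      by (simp add: nn_integral_density nn_integral_sqrt_r[symmetric] ennreal_mult[symmetric] less_imp_le)
  qed
  have "(\<integral>\<^sup>+ x. Y n x \<partial>QM) = (\<Prod>j\<in>{0..<n}. \<integral>\<^sup>+ a. ennreal (1 / sqrt (r j a)) \<partial>density (M j) (\<lambda>a. ennreal (r j a)))" for n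
    unfolding Y_def by (rule Q.nn_integral_prod_components) auto
  then have Yn: "(\<integral>\<^sup>+ x. Y n x \<partial>QM) = ennreal (\<Prod>j\<in>{0..<n}. rho j)" for n
    by (simp only: one) (simp add: prod_ennreal rho_nonneg)
  have "(\<integral>\<^sup>+ x. liminf (\<lambda>n. Y n x) \<partial>QM) \<le> liminf (\<lambda>n. \<integral>\<^sup>+ x. Y n x \<partial>QM)"
    by (rule nn_integral_liminf) measurable
  also have "\<dots> = ennreal 0"
    unfolding Yn by (intro lim_imp_Liminf tendsto_ennrealI prod_rho_tendsto_0 assms) simp
  finally have "(\<integral>\<^sup>+ x. liminf (\<lambda>n. Y n x) \<partial>QM) = 0" by simp
  then have "AE x in QM. liminf (\<lambda>n. Y n x) = 0"
    by (subst (asm) nn_integral_0_iff_AE) auto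
  then show ?thesis
  proof eventually_elim
    case (elim x)
    show ?case
    proof
      assume "(\<lambda>n. \<Prod>j<n. r j (x j)) \<longlonglongrightarrow> 0"
      then have "\<forall>\<^sub>F n in sequentially. lik 0 n x < 1"
        unfolding lik_def lessThan_atLeast0 by (rule order_tendstoD) simp
      then have "\<forall>\<^sub>F n in sequentially. 1 \<le> Y n x"
      proof eventually_elim
        case (elim n)
        have "Y n x = ennreal (\<Prod>j\<in>{0..<n}. 1 / sqrt (r j (x j)))"
          unfolding Y_def using r_pos by (intro prod_ennreal) (auto simp: less_imp_le)
        also have "(\<Prod>j\<in>{0..<n}. 1 / sqrt (r j (x j))) = 1 / sqrt (lik 0 n x)"
          by (simp add: lik_def sqrt_prod prod_dividef)
        finally show ?case using elim lik_pos[of 0 n x] by (simp add: ennreal_ge_1)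
      qed
      then have "1 \<le> liminf (\<lambda>n. Y n x)" by (rule Liminf_bounded)
      then show False using elim by simp
    qed
  qed
qed

end

section \<open>Potentials of product type\<close>

lemma abs_exp_minus_one_le:
  fixes t s :: real
  assumes "\<bar>t\<bar> \<le> s"
  shows "\<bar>exp t - 1\<bar> \<le> s * exp s"
proof (cases "0 \<le> t")
  case True
  have "1 - exp (- t) \<le> t" using exp_ge_add_one_self[of "- t"] by simp
  then have "exp t * (1 - exp (- t)) \<le> exp s * s"
    using True assms exp_ge_add_one_self[of "- t"] by (intro mult_mono) auto
  moreover have "exp t * (1 - exp (- t)) = exp t - 1"
    by (simp add: right_diff_distrib flip: exp_add)
  ultimately show ?thesis using True by (simp add: mult.commute)
next
  case False
  have "1 - exp t \<le> - t" using exp_ge_add_one_self[of t] by linarith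
  also have "\<dots> \<le> s * 1" using assms by simp
  also have "\<dots> \<le> s * exp s" using assms by (intro mult_left_mono) auto
  finally show ?thesis using False by simp
qed

text \<open>Twice the defect is the mean of the square of \<open>sqrt (r j a) - 1\<close>, and the
  root halves the logarithm. The bound is quadratic in s, which is what a condition on squares of
  tails can feed.\<close>

lemma (in kakutani) one_minus_rho_le:
  assumes "\<And>a. \<bar>ln (r j a)\<bar> \<le> 2 * s"
  shows "1 - rho j \<le> (s * exp s)\<^sup>2 / 2"
proof -
  have bound: "(sqrt (r j a) - 1)\<^sup>2 \<le> (s * exp s)\<^sup>2" for a
  proof -
    have "sqrt (r j a) = exp (ln (r j a) / 2)"
      using r_pos[of j a] by (intro real_sqrt_unique) (simp_all add: power2_eq_square flip: exp_add)
    then have "\<bar>sqrt (r j a) - 1\<bar> \<le> s * exp s"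
      using assms[of a] by (auto intro!: abs_exp_minus_one_le)
    then show ?thesis by (metis abs_ge_zero power2_abs power_mono)
  qed
  have eq: "(sqrt (r j a) - 1)\<^sup>2 = r j a + 1 - 2 * sqrt (r j a)" for a
    using r_pos[of j a] by (simp add: power2_eq_square algebra_simps)
  note int = integrable_r[of j] integrable_sqrt_r[of j]
  have "2 - 2 * rho j = (LINT a|M j. (sqrt (r j a) - 1)\<^sup>2)"
    unfolding eq using int integral_r[of j] by (simp add: rho_def M.prob_space)
  also have "\<dots> \<le> (LINT a|M j. (s * exp s)\<^sup>2)"
    using int bound by (intro integral_mono) (auto simp: eq)
  finally show ?thesis by (simp add: M.prob_space)
qed

section \<open>Probability measures given by summable weights\<close>

lemma nn_integral_count_space_eq_infsum:
  fixes w :: "'b \<Rightarrow> real"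
  assumes "w summable_on A" "\<And>a. a \<in> A \<Longrightarrow> 0 \<le> w a"
  shows "(\<integral>\<^sup>+ a. ennreal (w a) \<partial>count_space A) = ennreal (\<Sum>\<^sub>\<infinity>a\<in>A. w a)"
proof -
  have "Infinite_Set_Sum.abs_summable_on w A"
    using assms by (simp add: abs_summable_equivalent[symmetric] cong: summable_on_cong)
  then show ?thesis
    using assms(2) by (simp add: nn_integral_conv_infsetsum infsetsum_infsum)
qed

locale positive_weight =
  fixes w :: "'a :: countable \<Rightarrow> real"
  assumes pos: "\<And>a. 0 < w a" and summable: "w summable_on UNIV"
begin

lemma infsum_pos: "0 < (\<Sum>\<^sub>\<infinity>a. w a)"
proof -
  have "0 < sum w {undefined}" using pos by simp
  also have "\<dots> \<le> (\<Sum>\<^sub>\<infinity>a. w a)"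
    by (rule finite_sum_le_infsum) (auto simp: summable less_imp_le[OF pos])
  finally show ?thesis .
qed

lemma prob_space_weighted_measure: "prob_space (weighted_measure w)"
proof (rule prob_spaceI)
  have "(\<integral>\<^sup>+ a. ennreal (w a / (\<Sum>\<^sub>\<infinity>b. w b)) \<partial>count_space UNIV)
      = ennreal (\<Sum>\<^sub>\<infinity>a. w a / (\<Sum>\<^sub>\<infinity>b. w b))"
    using pos infsum_pos summable_on_cmult_left[OF summable, of "inverse (\<Sum>\<^sub>\<infinity>b. w b)"]
    by (intro nn_integral_count_space_eq_infsum) (auto simp: divide_inverse less_imp_le)
  also have "(\<Sum>\<^sub>\<infinity>a. w a / (\<Sum>\<^sub>\<infinity>b. w b)) = 1"
    using infsum_pos by (simp add: divide_inverse infsum_cmult_left')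
  finally show "emeasure (weighted_measure w) (space (weighted_measure w)) = 1"
    by (simp add: weighted_measure_def emeasure_density)
qed

end

lemma sets_weighted_measure [simp]: "sets (weighted_measure w) = UNIV"
  and space_weighted_measure [simp]: "space (weighted_measure w) = UNIV"
  by (simp_all add: weighted_measure_def)

lemma measurable_weighted_measure [measurable]: "u \<in> borel_measurable (weighted_measure w)"
  by (simp add: weighted_measure_def)

lemma abs_ln_le_iff:
  fixes x s :: real
  assumes "0 < x"
  shows "\<bar>ln x\<bar> \<le> s \<longleftrightarrow> exp (- s) \<le> x \<and> x \<le> exp s"
  using assms ln_ge_iff[of x "- s"] ln_le_cancel_iff[of x "exp s"] by auto

locale weight_pair = u: positive_weight u + v: positive_weight v
  for u v :: "'a :: countable \<Rightarrow> real"
begin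

text \<open>The Radon-Nikodym derivative of the normalised measure of \<open>v\<close> with respect
  to that of \<open>u\<close>.\<close>

definition ratio :: "'a \<Rightarrow> real" where
  "ratio a = v a / u a * ((\<Sum>\<^sub>\<infinity>b. u b) / (\<Sum>\<^sub>\<infinity>b. v b))"

lemma ratio_pos: "0 < ratio a"
  using u.pos v.pos u.infsum_pos v.infsum_pos by (simp add: ratio_def)

lemma density_ratio: "density (weighted_measure u) (\<lambda>a. ennreal (ratio a)) = weighted_measure v"
  unfolding weighted_measure_def
proof (subst density_density_eq)
  show "density (count_space UNIV) (\<lambda>a. ennreal (u a / infsum u UNIV) * ennreal (ratio a))
      = density (count_space UNIV) (\<lambda>a. ennreal (v a / infsum v UNIV))"
  proof (rule density_cong)
    show "AE a in count_space UNIV. ennreal (u a / infsum u UNIV) * ennreal (ratio a) = ennreal (v a / infsum v UNIV)"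
    proof (rule AE_I2)
      fix a
      have "u a / infsum u UNIV * ratio a = v a / infsum v UNIV"
        using u.pos[of a] u.infsum_pos by (simp add: ratio_def)
      then show "ennreal (u a / infsum u UNIV) * ennreal (ratio a) = ennreal (v a / infsum v UNIV)"
        using u.pos[of a] u.infsum_pos ratio_pos[of a] by (simp flip: ennreal_mult)
    qed
  qed auto
qed auto

lemma nn_integral_ratio: "(\<integral>\<^sup>+ a. ennreal (ratio a) \<partial>weighted_measure u) = 1"
proof -
  have "(\<integral>\<^sup>+ a. ennreal (ratio a) \<partial>weighted_measure u)
      = emeasure (density (weighted_measure u) (\<lambda>a. ennreal (ratio a))) UNIV"
    by (simp add: emeasure_density)
  also have "\<dots> = 1"
    using prob_space.emeasure_space_1[OF v.prob_space_weighted_measure] by (simp add: density_ratio)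
  finally show ?thesis .
qed

text \<open>Pointwise two-sided bounds between \<open>u\<close> and \<open>v\<close> with the factor
  \<open>exp s\<close> survive summation, hence also hold between the totals.\<close>

lemma abs_ln_infsum_ratio_le:
  assumes s: "\<And>a. \<bar>ln (v a / u a)\<bar> \<le> s"
  shows "\<bar>ln ((\<Sum>\<^sub>\<infinity>b. u b) / (\<Sum>\<^sub>\<infinity>b. v b))\<bar> \<le> s"
proof -
  have e: "exp (- s) \<le> v a / u a" "v a / u a \<le> exp s" for a
    using s[of a] u.pos[of a] v.pos[of a] by (simp_all add: abs_ln_le_iff)
  have "v a \<le> exp s * u a" "u a \<le> exp s * v a" for a
    using e[of a] u.pos[of a] by (simp_all add: field_simps exp_minus)
  then have "(\<Sum>\<^sub>\<infinity>b. v b) \<le> (\<Sum>\<^sub>\<infinity>b. exp s * u b)" "(\<Sum>\<^sub>\<infinity>b. u b) \<le> (\<Sum>\<^sub>\<infinity>b. exp s * v b)"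
    by (auto intro!: infsum_mono summable_on_cmult_right u.summable v.summable)
  then have "(\<Sum>\<^sub>\<infinity>b. v b) \<le> exp s * (\<Sum>\<^sub>\<infinity>b. u b)" "(\<Sum>\<^sub>\<infinity>b. u b) \<le> exp s * (\<Sum>\<^sub>\<infinity>b. v b)"
    by (simp_all add: infsum_cmult_right')
  then have "exp (- s) \<le> (\<Sum>\<^sub>\<infinity>b. u b) / (\<Sum>\<^sub>\<infinity>b. v b)" "(\<Sum>\<^sub>\<infinity>b. u b) / (\<Sum>\<^sub>\<infinity>b. v b) \<le> exp s"
    using v.infsum_pos by (simp_all add: field_simps exp_minus)
  moreover have "0 < (\<Sum>\<^sub>\<infinity>b. u b) / (\<Sum>\<^sub>\<infinity>b. v b)"
    using u.infsum_pos v.infsum_pos by simp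
  ultimately show ?thesis
    by (simp add: abs_ln_le_iff)
qed

text \<open>One s comes from the weights and one from the normalising constants;
  \<open>one_minus_rho_le\<close> takes its hypothesis in the matching form.\<close>

lemma abs_ln_ratio_le:
  assumes "\<And>a. \<bar>ln (v a / u a)\<bar> \<le> s"
  shows "\<bar>ln (ratio a)\<bar> \<le> 2 * s"
proof -
  have "ln (ratio a) = ln (v a / u a) + ln ((\<Sum>\<^sub>\<infinity>b. u b) / (\<Sum>\<^sub>\<infinity>b. v b))"
    unfolding ratio_def using u.pos[of a] v.pos[of a] u.infsum_pos v.infsum_pos
    by (intro ln_mult_pos) auto
  then show ?thesis using assms[of a] abs_ln_infsum_ratio_le[OF assms] by simp
qed

end

lemma kakutani_ratio:
  assumes "\<And>n. weight_pair (u n) (v n)"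
  shows "kakutani (\<lambda>n. weighted_measure (u n)) (\<lambda>n. weight_pair.ratio (u n) (v n))"
proof -
  interpret weight_pair "u n" "v n" for n by (rule assms)
  interpret sequence_prob_space "\<lambda>n. weighted_measure (u n)"
    by (intro sequence_prob_spaceI u.prob_space_weighted_measure)
  show ?thesis
    by unfold_locales (auto intro: ratio_pos nn_integral_ratio)
qed

text \<open>The limit is an exponential, so it is nonzero as \<open>raw_has_prod\<close>
  demands.\<close>

lemma has_prod_exp_suminf:
  fixes u :: "nat \<Rightarrow> real"
  assumes "\<And>i. 0 < u i" "summable (\<lambda>i. ln (u i))"
  shows "u has_prod exp (\<Sum>i. ln (u i))"
proof -
  have "(\<lambda>n. exp (\<Sum>i\<le>n. ln (u i))) \<longlonglongrightarrow> exp (\<Sum>i. ln (u i))"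
    using assms(2) by (intro tendsto_exp summable_LIMSEQ')
  then show ?thesis
    using assms(1) by (simp add: has_prod_def raw_has_prod_def exp_sum)
qed

section \<open>Weights, tails and normalising constants of a potential\<close>

locale potential =
  fixes g :: "(nat \<Rightarrow> 'a :: countable) \<Rightarrow> real" and g0 :: real and f :: "nat \<Rightarrow> 'a \<Rightarrow> real"
  assumes product_type: "product_type g g0 f"
    and l1: "l1_bounded f"
    and summable_f0: "summable_potential f"
begin

lemma g0_pos: "0 < g0" and f_pos: "0 < f i a"
  and summable_ln: "summable (\<lambda>i. ln (f i (x i)))"
  and g_eq: "g x = g0 * (\<Prod>i. f i (x i))"
  using product_type by (auto simp: product_type_def)

text \<open>The sup norm of the logarithm of a factor. The factor \<open>f 0\<close> is left out:
  over an infinite alphabet its summability makes its logarithm unbounded.\<close>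

definition osc :: "nat \<Rightarrow> real" where
  "osc k = enn2real (SUP a. ennreal \<bar>ln (f (Suc k) a)\<bar>)"

text \<open>A term of a series with finite sum is finite, so \<open>enn2real\<close> loses
  nothing.\<close>

lemma ennreal_osc: "ennreal (osc k) = (SUP a. ennreal \<bar>ln (f (Suc k) a)\<bar>)"
proof -
  have "(SUP a. ennreal \<bar>ln (f (Suc k) a)\<bar>) \<le> (\<Sum>k. SUP a. ennreal \<bar>ln (f (Suc k) a)\<bar>)"
    using sum_le_suminf[of "\<lambda>k. SUP a. ennreal \<bar>ln (f (Suc k) a)\<bar>" "{k}"] by auto
  also have "\<dots> < \<infinity>" using l1 by (simp add: l1_bounded_def)
  finally show ?thesis by (simp add: osc_def)
qed

lemma abs_ln_f_le: "\<bar>ln (f (Suc k) a)\<bar> \<le> osc k"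
proof -
  have "ennreal \<bar>ln (f (Suc k) a)\<bar> \<le> ennreal (osc k)"
    unfolding ennreal_osc by (rule SUP_upper) simp
  then show ?thesis by (simp add: osc_def)
qed

lemma osc_nonneg: "0 \<le> osc k"
  by (simp add: osc_def)

lemma summable_osc: "summable osc"
  using l1 by (intro summable_suminf_not_top) (auto simp: osc_nonneg ennreal_osc l1_bounded_def)

definition osc_tail :: "nat \<Rightarrow> real" where
  "osc_tail n = (\<Sum>k. osc (k + n))"

lemma osc_tail_tendsto_0: "osc_tail \<longlonglongrightarrow> 0"
  unfolding osc_tail_def by (rule suminf_exist_split2[OF summable_osc])

lemma osc_tail_le: "osc_tail n \<le> osc_tail 0"
proof -
  have "osc_tail 0 = osc_tail n + (\<Sum>i<n. osc i)"
    unfolding osc_tail_def using suminf_split_initial_segment[OF summable_osc, of n] by simp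
  then show ?thesis using sum_nonneg[of "{..<n}" osc] osc_nonneg by simp
qed

lemma osc_le: "osc n \<le> osc_tail 0"
  unfolding osc_tail_def using sum_le_suminf[OF summable_osc, of "{n}"] osc_nonneg by simp

text \<open>The logarithm of the quotient of \<open>weight_lim\<close> by \<open>weight n\<close>;
  as \<open>weight n\<close> includes index n, the sum starts at \<open>Suc n\<close>.\<close>

definition tail :: "nat \<Rightarrow> 'a \<Rightarrow> real" where
  "tail n a = (\<Sum>l. ln (f (l + Suc n) a))"

lemma summable_ln_tail: "summable (\<lambda>l. ln (f (l + n) a))"
  using summable_ln[of "\<lambda>_. a"] by (simp add: summable_iff_shift[of "\<lambda>l. ln (f l a)"])

lemma abs_tail_le: "\<bar>tail n a\<bar> \<le> osc_tail n"
proof -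
  have "summable (\<lambda>l. osc (l + n))" using summable_osc by (simp add: summable_iff_shift)
  then have "norm (\<Sum>l. ln (f (l + Suc n) a)) \<le> (\<Sum>l. osc (l + n))"
    by (intro norm_suminf_le) (use abs_ln_f_le[of _ a] in auto)
  then show ?thesis by (simp add: tail_def osc_tail_def)
qed

definition weight :: "nat \<Rightarrow> 'a \<Rightarrow> real" where
  "weight n a = (\<Prod>i\<le>n. f i a)"

definition weight_lim :: "'a \<Rightarrow> real" where
  "weight_lim a = (\<Prod>i. f i a)"

lemma prodinf_tail: "(\<Prod>l. f (l + Suc n) a) = exp (tail n a)"
  unfolding tail_def
  by (intro has_prod_unique[symmetric] has_prod_exp_suminf f_pos summable_ln_tail)

lemma weight_pos: "0 < weight n a"
  unfolding weight_def by (intro prod_pos) (auto simp: f_pos)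

lemma weight_lim_eq: "weight_lim a = weight n a * exp (tail n a)"
proof -
  have "weight_lim a = exp (\<Sum>i. ln (f i a))"
    unfolding weight_lim_def
    using summable_ln_tail[of 0 a] by (intro has_prod_unique[symmetric] has_prod_exp_suminf f_pos) simp
  also have "(\<Sum>i. ln (f i a)) = tail n a + (\<Sum>i<Suc n. ln (f i a))"
    using suminf_split_initial_segment[of "\<lambda>i. ln (f i a)" "Suc n"] summable_ln_tail[of 0 a]
    by (simp add: tail_def)
  also have "exp \<dots> = weight n a * exp (tail n a)"
    by (simp add: exp_add exp_sum f_pos weight_def lessThan_Suc_atMost del: sum.lessThan_Suc)
  finally show ?thesis .
qed

lemma weight_lim_pos: "0 < weight_lim a"
  using weight_lim_eq[of a 0] weight_pos[of 0 a] by simp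

text \<open>The factors after the first change the weight by at most a constant, so summability
  passes from \<open>f 0\<close> to the limit weight, and then back to every
  \<open>weight n\<close>.\<close>

lemma summable_weight_lim: "weight_lim summable_on UNIV"
proof (rule summable_on_comparison_test)
  show "(\<lambda>a. exp (osc_tail 0) * f 0 a) summable_on UNIV"
    using summable_f0 by (intro summable_on_cmult_right) (simp add: summable_potential_def)
  show "weight_lim a \<le> exp (osc_tail 0) * f 0 a" for a
    using abs_tail_le[of 0 a] f_pos[of 0 a] weight_lim_eq[of a 0] by (simp add: weight_def)
  show "0 \<le> weight_lim a" for a using weight_lim_pos[of a] by simp
qed

lemma summable_weight: "weight n summable_on UNIV"
proof (rule summable_on_comparison_test)
  show "(\<lambda>a. exp (osc_tail n) * weight_lim a) summable_on UNIV"
    using summable_weight_lim by (rule summable_on_cmult_right)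
  show "weight n a \<le> exp (osc_tail n) * weight_lim a" for a
  proof -
    have "weight n a * 1 \<le> weight n a * exp (osc_tail n + tail n a)"
      using abs_tail_le[of n a] weight_pos[of n a] by (intro mult_left_mono) auto
    then show ?thesis by (simp add: weight_lim_eq[of a n] exp_add mult_ac)
  qed
  show "0 \<le> weight n a" for a using weight_pos[of n a] by simp
qed

sublocale W: positive_weight "weight n" for n
  by unfold_locales (rule weight_pos, rule summable_weight)

sublocale Wlim: positive_weight weight_lim
  by unfold_locales (rule weight_lim_pos, rule summable_weight_lim)

sublocale to_lim: weight_pair "weight n" weight_lim for n ..

text \<open>This pair compares consecutive marginals, that is, \<open>mu f\<close> with its image
  under the shift.\<close>

sublocale to_Suc: weight_pair "weight n" "weight (Suc n)" for n ..

abbreviation "Z n \<equiv> \<Sum>\<^sub>\<infinity>a. weight n a"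
abbreviation "Z_lim \<equiv> \<Sum>\<^sub>\<infinity>a. weight_lim a"

lemma weight_lim_quotient: "weight_lim a / weight n a = exp (tail n a)"
  using weight_pos[of n a] by (simp add: weight_lim_eq[of a n])

lemma weight_Suc_quotient: "weight (Suc n) a / weight n a = f (Suc n) a"
proof -
  have "weight (Suc n) a = weight n a * f (Suc n) a" by (simp add: weight_def)
  then show ?thesis using weight_pos[of n a] by simp
qed

text \<open>The bound on \<open>tail n\<close> is uniform in the letter, so it applies to the
  logarithm of the quotient of the totals as well.\<close>

lemma Z_tendsto: "Z \<longlonglongrightarrow> Z_lim"
proof -
  have "\<bar>ln (Z n / Z_lim)\<bar> \<le> osc_tail n" for n
    by (rule to_lim.abs_ln_infsum_ratio_le) (simp add: weight_lim_quotient abs_tail_le)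
  then have "(\<lambda>n. ln (Z n / Z_lim)) \<longlonglongrightarrow> 0"
    by (intro Lim_null_comparison[OF _ osc_tail_tendsto_0]) (auto intro: always_eventually)
  then have "(\<lambda>n. exp (ln (Z n / Z_lim)) * Z_lim) \<longlonglongrightarrow> exp 0 * Z_lim"
    by (intro tendsto_intros)
  moreover have "exp (ln (Z n / Z_lim)) * Z_lim = Z n" for n
    using W.infsum_pos[of n] Wlim.infsum_pos by simp
  ultimately show ?thesis by simp
qed

lemma ratio_to_lim: "to_lim.ratio n a = Z n / Z_lim * exp (tail n a)"
  by (simp add: to_lim.ratio_def weight_lim_quotient mult_ac)

lemma ratio_to_Suc: "to_Suc.ratio n a = f (Suc n) a * (Z n / Z (Suc n))"
  by (simp add: to_Suc.ratio_def weight_Suc_quotient)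

lemma h_factor_eq_ratio: "h_factor f x j = to_lim.ratio j (x j)"
  unfolding h_factor_def ratio_to_lim prodinf_tail
  by (simp add: weight_def[abs_def] weight_lim_def[abs_def])

lemma h_factor_pos: "0 < h_factor f x j"
  by (simp add: h_factor_eq_ratio to_lim.ratio_pos)

section \<open>The dichotomy for the measures of the theorem\<close>

sublocale K: kakutani "\<lambda>n. weighted_measure (weight n)" "\<lambda>n. to_lim.ratio n"
  by (rule kakutani_ratio) (rule to_lim.weight_pair_axioms)

lemma mu_eq: "mu f = Pi\<^sub>M UNIV (\<lambda>n. weighted_measure (weight n))"
  by (simp add: mu_def weight_def[abs_def])

lemma mu_tilde_eq:
  "mu_tilde f = Pi\<^sub>M UNIV (\<lambda>n. density (weighted_measure (weight n)) (\<lambda>a. ennreal (to_lim.ratio n a)))"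
  unfolding to_lim.density_ratio by (simp add: mu_tilde_def weight_lim_def[abs_def])

text \<open>Partial products are positive, so a limit is automatically nonnegative. The Cauchy form
  shows that the set of existence is measurable.\<close>

lemma h_mu_exists_iff: "h_mu_exists f x \<longleftrightarrow> Cauchy (\<lambda>n. \<Prod>j<n. h_factor f x j)"
proof
  assume "Cauchy (\<lambda>n. \<Prod>j<n. h_factor f x j)"
  then obtain L where "(\<lambda>n. \<Prod>j<n. h_factor f x j) \<longlonglongrightarrow> L"
    by (auto simp: Cauchy_convergent_iff convergent_def)
  moreover from this have "0 \<le> L"
    by (rule LIMSEQ_le_const) (auto intro!: prod_nonneg less_imp_le[OF h_factor_pos])
  ultimately show "h_mu_exists f x" by (auto simp: h_mu_exists_def)
qed (auto simp: h_mu_exists_def Cauchy_convergent_iff convergent_def)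

lemma measurable_h_factor [measurable]: "(\<lambda>x. h_factor f x j) \<in> borel_measurable (mu f)"
  unfolding h_factor_eq_ratio mu_eq by measurable

lemma measurable_h_mu_exists [measurable]: "Measurable.pred (mu f) (h_mu_exists f)"
  unfolding h_mu_exists_iff pred_def by (intro sets_Collect_Cauchy) measurable

lemma measurable_h_mu [measurable]: "h_mu f \<in> borel_measurable (mu f)"
proof -
  have "(\<lambda>x. lim (\<lambda>n. \<Prod>j<n. h_factor f x j)) \<in> borel_measurable (mu f)"
    by (rule borel_measurable_lim_metric) measurable
  then show ?thesis unfolding h_mu_def[abs_def] by measurable
qed

lemma h_mu_eqI:
  assumes "(\<lambda>n. \<Prod>j<n. h_factor f x j) \<longlonglongrightarrow> L"
  shows "h_mu_exists f x" "h_mu f x = L"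
proof -
  show "h_mu_exists f x"
    using assms by (auto simp: h_mu_exists_iff Cauchy_convergent_iff convergent_def)
  then show "h_mu f x = L" using assms by (simp add: h_mu_def limI)
qed

lemma h_mu_nonneg: "0 \<le> h_mu f x"
proof (cases "h_mu_exists f x")
  case True
  then show ?thesis using h_mu_eqI(2) by (auto simp: h_mu_exists_def)
qed (simp add: h_mu_def)

lemma prob_space_mu: "prob_space (mu f)"
  unfolding mu_eq by (rule K.P.prob_space_axioms)

lemma sets_mu_tilde: "sets (mu_tilde f) = sets (mu f)"
  unfolding mu_eq mu_tilde_eq by (rule K.sets_QM)

lemma prob_space_mu_tilde: "prob_space (mu_tilde f)"
proof -
  interpret Q: sequence_prob_space "\<lambda>n. density (weighted_measure (weight n)) (\<lambda>a. ennreal (to_lim.ratio n a))"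
    by (rule K.sequence_prob_space_QM)
  show ?thesis unfolding mu_tilde_eq by (rule Q.P.prob_space_axioms)
qed

lemma summable_case:
  assumes "summable (\<lambda>j. 1 - K.rho j)"
  shows "AE x in mu f. h_mu_exists f x \<and> 0 < h_mu f x"
    and "mu_tilde f = density (mu f) (\<lambda>x. ennreal (h_mu f x))"
    and "(\<integral>\<^sup>+ x. ennreal (h_mu f x) \<partial>mu f) = 1"
proof -
  have ex: "AE x in mu f. \<exists>l>0. (\<lambda>n. \<Prod>j<n. h_factor f x j) \<longlonglongrightarrow> l"
    unfolding mu_eq h_factor_eq_ratio by (rule K.AE_lik_converges_pos[OF assms])
  then show "AE x in mu f. h_mu_exists f x \<and> 0 < h_mu f x"
    by eventually_elim (use h_mu_eqI in blast)
  show dens: "mu_tilde f = density (mu f) (\<lambda>x. ennreal (h_mu f x))"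
    unfolding mu_tilde_eq mu_eq
  proof (rule K.QM_eq_density[OF assms])
    show "h_mu f \<in> borel_measurable (Pi\<^sub>M UNIV (\<lambda>n. weighted_measure (weight n)))"
      using measurable_h_mu unfolding mu_eq .
    have "AE x in mu f. (\<lambda>n. \<Prod>j<n. h_factor f x j) \<longlonglongrightarrow> h_mu f x"
      using ex by eventually_elim (use h_mu_eqI in blast)
    then show "AE x in Pi\<^sub>M UNIV (\<lambda>n. weighted_measure (weight n)). (\<lambda>n. \<Prod>j<n. to_lim.ratio j (x j)) \<longlonglongrightarrow> h_mu f x"
      unfolding mu_eq h_factor_eq_ratio .
  qed
  have "(\<integral>\<^sup>+ x. ennreal (h_mu f x) \<partial>mu f) = emeasure (mu_tilde f) (space (mu_tilde f))"
    unfolding dens by (simp add: emeasure_density cong: nn_integral_cong)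
  then show "(\<integral>\<^sup>+ x. ennreal (h_mu f x) \<partial>mu f) = 1"
    using prob_space.emeasure_space_1[OF prob_space_mu_tilde] by simp
qed

text \<open>The conjunction tells a true limit 0 from the default value of \<open>h_mu\<close> at
  points without a limit. Only the former is excluded under \<open>mu_tilde f\<close>.\<close>

lemma nonsummable_case:
  assumes "\<not> summable (\<lambda>j. 1 - K.rho j)"
  shows "AE x in mu f. h_mu_exists f x \<and> h_mu f x = 0"
    and "AE x in mu_tilde f. \<not> (h_mu_exists f x \<and> h_mu f x = 0)"
proof -
  have "AE x in mu f. (\<lambda>n. \<Prod>j<n. h_factor f x j) \<longlonglongrightarrow> 0"
    unfolding mu_eq h_factor_eq_ratio by (rule K.AE_lik_tendsto_0[OF assms])
  then show "AE x in mu f. h_mu_exists f x \<and> h_mu f x = 0"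
    by eventually_elim (use h_mu_eqI in blast)
  have "AE x in mu_tilde f. \<not> (\<lambda>n. \<Prod>j<n. h_factor f x j) \<longlonglongrightarrow> 0"
    unfolding mu_tilde_eq h_factor_eq_ratio by (rule K.AE_QM_not_lik_tendsto_0[OF assms])
  then show "AE x in mu_tilde f. \<not> (h_mu_exists f x \<and> h_mu f x = 0)"
  proof eventually_elim
    case (elim x)
    then show ?case using h_mu_eqI(2) by (auto simp: h_mu_exists_def)
  qed
qed

lemma h_mu_exists_AE: "AE x in mu f. h_mu_exists f x"
  using summable_case(1) nonsummable_case(1)
  by (cases "summable (\<lambda>j. 1 - K.rho j)") (auto elim: eventually_mono)

text \<open>One direction is the existence of a density, the other its positivity almost
  everywhere.\<close>

lemma summable_case_equivalent:
  assumes "summable (\<lambda>j. 1 - K.rho j)"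
  shows "equivalent_measures (mu f) (mu_tilde f)"
  unfolding equivalent_measures_def
proof
  show "absolutely_continuous (mu f) (mu_tilde f)"
    unfolding summable_case(2)[OF assms] by (rule absolutely_continuousI_density) simp
  show "absolutely_continuous (mu_tilde f) (mu f)"
    unfolding absolutely_continuous_def
  proof
    fix S assume S: "S \<in> null_sets (mu_tilde f)"
    then have [measurable]: "S \<in> sets (mu f)" by (auto simp: null_sets_def sets_mu_tilde)
    have "AE x in mu f. x \<in> S \<longrightarrow> h_mu f x = 0"
      using S unfolding summable_case(2)[OF assms]
      by (subst (asm) null_sets_density_iff) (auto simp: h_mu_nonneg ennreal_eq_0_iff elim!: eventually_mono intro: antisym)
    with summable_case(1)[OF assms] have "AE x in mu f. x \<notin> S"
      by eventually_elim auto
    then show "S \<in> null_sets (mu f)" by (simp add: AE_iff_null_sets)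
  qed
qed

text \<open>The set on which the partial products tend to 0 is null for \<open>mu_tilde f\<close>
  and has a null complement for \<open>mu f\<close>. Equivalence would then make the whole space
  null for \<open>mu f\<close>.\<close>

lemma nonsummable_case_singular:
  assumes "\<not> summable (\<lambda>j. 1 - K.rho j)"
  shows "singular_measures (mu_tilde f) (mu f)"
    and "\<not> equivalent_measures (mu f) (mu_tilde f)"
proof -
  define S where "S = {x \<in> space (mu f). h_mu_exists f x \<and> h_mu f x = 0}"
  have S [measurable]: "S \<in> sets (mu f)" unfolding S_def by measurable
  have St: "S \<in> sets (mu_tilde f)" using S by (simp add: sets_mu_tilde)
  have "AE x in mu_tilde f. x \<notin> S"
    using nonsummable_case(2)[OF assms] by eventually_elim (auto simp: S_def)
  then have null: "S \<in> null_sets (mu_tilde f)" using St by (simp add: AE_iff_null_sets)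
  have "AE x in mu f. x \<notin> space (mu f) - S"
    using nonsummable_case(1)[OF assms] by eventually_elim (auto simp: S_def)
  then have null': "space (mu f) - S \<in> null_sets (mu f)"
    by (rule iffD2[OF AE_iff_null_sets, rotated]) measurable
  show "singular_measures (mu_tilde f) (mu f)"
    using null null' St by (auto simp: singular_measures_def sets_mu_tilde)
  show "\<not> equivalent_measures (mu f) (mu_tilde f)"
  proof
    assume "equivalent_measures (mu f) (mu_tilde f)"
    then have "S \<in> null_sets (mu f)"
      using null by (auto simp: equivalent_measures_def absolutely_continuous_def)
    then have "S \<union> (space (mu f) - S) \<in> null_sets (mu f)" using null' by (rule null_sets.Un)
    moreover have "S \<union> (space (mu f) - S) = space (mu f)" by (auto simp: S_def)
    ultimately show False
      using prob_space.emeasure_space_1[OF prob_space_mu] by (simp add: null_sets_def)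
  qed
qed

lemma summable_rho_if_square_summable:
  assumes "(\<Sum>i. SUP a. ennreal ((\<Sum>j. ln (f (j + (i + k)) a))\<^sup>2)) < \<infinity>"
  shows "summable (\<lambda>j. 1 - K.rho j)"
proof -
  define B where "B i = enn2real (SUP a. ennreal ((\<Sum>j. ln (f (j + (i + k)) a))\<^sup>2))" for i
  have B: "ennreal (B i) = (SUP a. ennreal ((\<Sum>j. ln (f (j + (i + k)) a))\<^sup>2))" for i
  proof -
    have "(SUP a. ennreal ((\<Sum>j. ln (f (j + (i + k)) a))\<^sup>2)) \<le> (\<Sum>i. SUP a. ennreal ((\<Sum>j. ln (f (j + (i + k)) a))\<^sup>2))"
      using sum_le_suminf[of "\<lambda>i. SUP a. ennreal ((\<Sum>j. ln (f (j + (i + k)) a))\<^sup>2)" "{i}"] by auto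
    also note assms
    finally show ?thesis by (simp add: B_def)
  qed
  have B0: "0 \<le> B i" for i by (simp add: B_def)
  have "summable B"
    using assms by (intro summable_suminf_not_top) (auto simp: B B0)
  then have sB: "summable (\<lambda>i. B (Suc i))" by (simp add: summable_Suc_iff)
  \<comment> \<open>\<open>tail (i + k)\<close> starts at index \<open>Suc (i + k)\<close>, so it
    belongs to the next term of the series of the hypothesis.\<close>
  have tail_B: "(tail (i + k) a)\<^sup>2 \<le> B (Suc i)" for i a
  proof -
    have "ennreal ((tail (i + k) a)\<^sup>2) \<le> ennreal (B (Suc i))"
      unfolding B by (rule SUP_upper2[of a]) (simp_all add: tail_def add.commute[of _ "Suc _"] add.assoc)
    then show ?thesis using B0 by (simp add: ennreal_le_iff)
  qed
  define S where "S = osc_tail 0"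
  have bound: "1 - K.rho (i + k) \<le> B (Suc i) * ((exp S)\<^sup>2 / 2)" for i
  proof -
    \<comment> \<open>Both bounds on s are used: the root of \<open>B (Suc i)\<close> gives the
      summable square, and \<open>S\<close> keeps the exponential bounded.\<close>
    define s where "s = min (sqrt (B (Suc i))) S"
    have ts: "\<bar>tail (i + k) a\<bar> \<le> s" for a
    proof -
      have "\<bar>tail (i + k) a\<bar> \<le> sqrt (B (Suc i))"
        using tail_B[of i a] by (metis real_sqrt_abs real_sqrt_le_mono)
      moreover have "\<bar>tail (i + k) a\<bar> \<le> S"
        using abs_tail_le[of "i + k" a] osc_tail_le[of "i + k"] by (simp add: S_def)
      ultimately show ?thesis by (simp add: s_def)
    qed
    then have s0: "0 \<le> s" using ts[of undefined] by linarith
    have "1 - K.rho (i + k) \<le> (s * exp s)\<^sup>2 / 2"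
      by (rule K.one_minus_rho_le, rule to_lim.abs_ln_ratio_le) (simp add: weight_lim_quotient ts)
    also have "(s * exp s)\<^sup>2 \<le> (sqrt (B (Suc i)) * exp S)\<^sup>2"
      using s0 by (intro power_mono mult_mono) (auto simp: s_def B0)
    also have "\<dots> = B (Suc i) * (exp S)\<^sup>2" by (simp add: power_mult_distrib B0)
    finally show ?thesis by simp
  qed
  have "summable (\<lambda>i. 1 - K.rho (i + k))"
  proof (rule summable_comparison_test'[of _ 0])
    show "summable (\<lambda>i. B (Suc i) * ((exp S)\<^sup>2 / 2))" by (rule summable_mult2[OF sB])
    show "norm (1 - K.rho (i + k)) \<le> B (Suc i) * ((exp S)\<^sup>2 / 2)" for i
      using bound[of i] K.rho_le_1[of "i + k"] by (simp del: times_divide_eq_right)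
  qed
  then show ?thesis by (simp add: summable_iff_shift[of "\<lambda>j. 1 - K.rho j"])
qed

end

section \<open>Eigenfunctions of the Ruelle operator\<close>

context sequence_prob_space
begin

lemma measurable_case_nat [measurable]:
  "(\<lambda>(a, x). case_nat a x) \<in> measurable (M 0 \<Otimes>\<^sub>M Pi\<^sub>M UNIV (\<lambda>n. M (Suc n))) PM"
  unfolding split_beta'
proof (rule measurable_PiM_single')
  fix i :: nat
  show "(\<lambda>\<omega>. case_nat (fst \<omega>) (snd \<omega>) i) \<in> measurable (M 0 \<Otimes>\<^sub>M Pi\<^sub>M UNIV (\<lambda>n. M (Suc n))) (M i)"
    by (cases i) (auto intro: measurable_compose[OF measurable_snd measurable_component_singleton])
qed (auto simp: space_pair_measure space_PiM PiE_iff split: nat.split)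

text \<open>The remaining sequence has the marginals \<open>M (Suc n)\<close>: without stationarity,
  dropping the first coordinate changes the measure. The preimage of a cylinder is a rectangle, as
  for splicing.\<close>

lemma distr_case_nat:
  "distr (M 0 \<Otimes>\<^sub>M Pi\<^sub>M UNIV (\<lambda>n. M (Suc n))) PM (\<lambda>(a, x). case_nat a x) = PM"
proof (rule PiM_eq)
  interpret S: sequence_prob_space "\<lambda>n. M (Suc n)"
    by (intro sequence_prob_spaceI) (rule M.prob_space_axioms)
  fix J :: "nat set" and F
  assume J: "finite J" and F: "\<And>j. j \<in> J \<Longrightarrow> F j \<in> sets (M j)"
  define G where "G j = (if j \<in> J then F j else space (M j))" for j
  have G: "G j \<in> sets (M j)" for j using F by (auto simp: G_def)
  define K where "K = {j. Suc j \<in> J}"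
  have K: "finite K" using J finite_vimageI[of J Suc] by (simp add: K_def vimage_def)
  let ?E = "prod_emb UNIV M J (Pi\<^sub>E J F)"
  let ?B = "prod_emb UNIV (\<lambda>n. M (Suc n)) K (\<Pi>\<^sub>E j\<in>K. F (Suc j))"
  have meas: "?E \<in> sets PM" "?B \<in> sets S.PM"
    using J K F by (auto intro!: sets_PiM_I simp: K_def)
  have "(\<lambda>(a, x). case_nat a x) -` ?E \<inter> space (M 0 \<Otimes>\<^sub>M S.PM) = G 0 \<times> ?B"
  proof (intro equalityI subsetI)
    fix p assume p: "p \<in> (\<lambda>(a, x). case_nat a x) -` ?E \<inter> space (M 0 \<Otimes>\<^sub>M S.PM)"
    obtain a x where [simp]: "p = (a, x)" by (cases p)
    have "a \<in> space (M 0)" "x \<in> space S.PM" "\<And>j. j \<in> J \<Longrightarrow> case_nat a x j \<in> F j"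
      using p by (auto simp: prod_emb_def space_pair_measure PiE_iff)
    from this(1,2) this(3)[of 0] this(3)[of "Suc _"] show "p \<in> G 0 \<times> ?B"
      by (auto simp: prod_emb_def K_def G_def space_PiM PiE_iff)
  next
    fix p assume p: "p \<in> G 0 \<times> ?B"
    obtain a x where [simp]: "p = (a, x)" by (cases p)
    have 1: "a \<in> G 0" "x \<in> space S.PM" "\<And>j. Suc j \<in> J \<Longrightarrow> x j \<in> F (Suc j)"
      using p by (auto simp: prod_emb_def K_def space_PiM PiE_iff)
    have 2: "a \<in> space (M 0)" using 1(1) G[of 0] sets.sets_into_space by blast
    have "case_nat a x j \<in> F j" if "j \<in> J" for j
      using 1 that by (cases j) (auto simp: G_def)
    moreover have "case_nat a x j \<in> space (M j)" for j
      using 1(2) 2 by (cases j) (auto simp: space_PiM PiE_iff)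
    ultimately show "p \<in> (\<lambda>(a, x). case_nat a x) -` ?E \<inter> space (M 0 \<Otimes>\<^sub>M S.PM)"
      using 1(2) 2 by (auto simp: prod_emb_def space_pair_measure space_PiM PiE_iff)
  qed
  then have "emeasure (distr (M 0 \<Otimes>\<^sub>M S.PM) PM (\<lambda>(a, x). case_nat a x)) ?E
      = emeasure (M 0 \<Otimes>\<^sub>M S.PM) (G 0 \<times> ?B)"
    using meas by (simp add: emeasure_distr)
  also have "\<dots> = emeasure (M 0) (G 0) * emeasure S.PM ?B"
    using meas G by (simp add: S.P.emeasure_pair_measure_Times)
  also have "emeasure S.PM ?B = (\<Prod>j\<in>K. emeasure (M (Suc j)) (F (Suc j)))"
    using K F by (intro S.emeasure_PiM_emb) (auto simp: K_def)
  also have "\<dots> = (\<Prod>j\<in>J - {0}. emeasure (M j) (F j))"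
    by (rule prod.reindex_bij_witness[of _ "\<lambda>j. j - 1" Suc]) (auto simp: K_def)
  also have "emeasure (M 0) (G 0) * \<dots> = (\<Prod>j\<in>J. emeasure (M j) (F j))"
    using J by (cases "0 \<in> J") (auto simp: G_def prod.remove[of J 0] M.emeasure_space_1)
  finally show "emeasure (distr (M 0 \<Otimes>\<^sub>M S.PM) PM (\<lambda>(a, x). case_nat a x)) ?E
      = (\<Prod>j\<in>J. emeasure (M j) (F j))" .
qed simp

text \<open>If \<open>B\<close> is a cylinder, then \<open>A n\<close> is exactly independent of it
  once n passes its coordinates. The statement extends to the generated sigma-algebra by complements
  and disjoint unions; it is the limit statement, not exact independence, that is inherited.\<close>

lemma prob_Int_future_tendsto:
  assumes B: "B \<in> sets PM"
    and A [measurable]: "\<And>n. A n \<in> sets PM"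
    and future: "\<And>n x y. x \<in> space PM \<Longrightarrow> y \<in> space PM \<Longrightarrow> \<forall>i\<ge>n. x i = y i \<Longrightarrow> x \<in> A n \<longleftrightarrow> y \<in> A n"
  shows "(\<lambda>n. measure PM (A n \<inter> B) - measure PM (A n) * measure PM B) \<longlonglongrightarrow> 0"
proof -
  let ?\<Omega> = "\<Pi>\<^sub>E i\<in>UNIV. space (M i)"
  have \<Omega>: "?\<Omega> = space PM" by (simp add: space_PiM)
  have "B \<in> sigma_sets ?\<Omega> (prod_algebra UNIV M)" using B by (simp add: sets_PiM)
  with Int_stable_prod_algebra prod_algebra_sets_into_space show ?thesis
  proof (induction rule: sigma_sets_induct_disjoint)
    case (basic B)
    then obtain J F where BJ: "B = prod_emb UNIV M J (Pi\<^sub>E J F)" "finite J"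
      and F: "\<And>i. i \<in> J \<Longrightarrow> F i \<in> sets (M i)"
      by (rule prod_algebraE) blast
    have [measurable]: "B \<in> sets PM" using BJ F by (auto intro!: sets_PiM_I)
    obtain k where k: "J \<subseteq> {..<k}" using BJ(2) finite_nat_bounded by blast
    have "measure PM (A n \<inter> B) = measure PM (A n) * measure PM B" if "k \<le> n" for n
    proof -
      have "emeasure PM (A n \<inter> B) = (\<integral>\<^sup>+ x. indicator B x * indicator (A n) x \<partial>PM)"
      proof -
        have "indicator B x * indicator (A n) x = (indicator (A n \<inter> B) x :: ennreal)" for x
          by (auto simp: indicator_def)
        then show ?thesis by simp
      qed
      also have "\<dots> = (\<integral>\<^sup>+ x. indicator B x \<partial>PM) * (\<integral>\<^sup>+ x. indicator (A n) x \<partial>PM)"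
      proof (rule nn_integral_mult_indep[where n = n])
        show "indicator B x = (indicator B y :: ennreal)"
          if "x \<in> space PM" "y \<in> space PM" "\<forall>i<n. x i = y i" for x y
        proof -
          have "x j = y j" if "j \<in> J" for j using that k \<open>k \<le> n\<close> \<open>\<forall>i<n. x i = y i\<close> by auto
          then show ?thesis using that(1,2)
            by (auto simp: indicator_def BJ(1) prod_emb_def PiE_iff space_PiM)
        qed
        show "indicator (A n) x = (indicator (A n) y :: ennreal)"
          if "x \<in> space PM" "y \<in> space PM" "\<forall>i\<ge>n. x i = y i" for x y
          using future[OF that] by (simp add: indicator_def)
      qed auto
      finally have "emeasure PM (A n \<inter> B) = emeasure PM B * emeasure PM (A n)" by simp
      then show ?thesis
        by (simp add: P.emeasure_eq_measure flip: ennreal_mult)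
    qed
    then show ?case
      by (intro tendsto_eventually) (auto simp: eventually_sequentially)
  next
    case empty
    then show ?case by simp
  next
    case (compl B)
    then have [measurable]: "B \<in> sets PM" by (simp add: sets_PiM)
    have "measure PM (A n \<inter> (?\<Omega> - B)) - measure PM (A n) * measure PM (?\<Omega> - B)
        = - (measure PM (A n \<inter> B) - measure PM (A n) * measure PM B)" for n
    proof -
      have "A n \<inter> (?\<Omega> - B) = A n - A n \<inter> B"
        using sets.sets_into_space[OF A[of n]] by (auto simp: \<Omega>)
      then have "measure PM (A n \<inter> (?\<Omega> - B)) = measure PM (A n) - measure PM (A n \<inter> B)"
        by (simp add: P.finite_measure_Diff)
      moreover have "measure PM (?\<Omega> - B) = 1 - measure PM B"
        unfolding \<Omega> by (rule P.prob_compl) simp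
      ultimately show ?thesis by (simp only: right_diff_distrib)
    qed
    then show ?case using tendsto_minus[OF compl(2)] by simp
  next
    case (union B)
    then have B [measurable]: "\<And>i. B i \<in> sets PM" by (auto simp: sets_PiM)
    let ?a = "\<lambda>i n. measure PM (A n \<inter> B i) - measure PM (A n) * measure PM (B i)"
    have sB: "(\<lambda>i. measure PM (B i)) sums measure PM (\<Union>i. B i)"
      using union(1) by (intro P.finite_measure_UNION) auto
    \<comment> \<open>A majorant free of n and summable over i, as the \<open>B i\<close> are
      disjoint; by Tannery's theorem the limit may be taken under the sum.\<close>
    have bound: "norm (?a i n) \<le> measure PM (B i)" for i n
    proof -
      have "measure PM (A n \<inter> B i) \<le> measure PM (B i)" by (intro P.finite_measure_mono) auto
      moreover have "measure PM (A n) * measure PM (B i) \<le> measure PM (B i)"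
        by (intro mult_left_le_one_le) auto
      moreover have "0 \<le> measure PM (A n \<inter> B i)" "0 \<le> measure PM (A n) * measure PM (B i)" by auto
      ultimately show ?thesis unfolding real_norm_def by linarith
    qed
    have "eventually (\<lambda>(i, n). norm (?a i n) \<le> measure PM (B i)) (sequentially \<times>\<^sub>F sequentially)"
      by (rule always_eventually) (use bound in auto)
    from tannerys_theorem[OF union(3) this sums_summable[OF sB] sequentially_bot]
    have "(\<lambda>n. \<Sum>i. ?a i n) \<longlonglongrightarrow> (\<Sum>i. 0)" by blast
    moreover have "(\<Sum>i. ?a i n) = measure PM (A n \<inter> (\<Union>i. B i)) - measure PM (A n) * measure PM (\<Union>i. B i)" for n
    proof (rule sums_unique[symmetric], rule sums_diff)
      have "(\<lambda>i. measure PM (A n \<inter> B i)) sums measure PM (\<Union>i. A n \<inter> B i)"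
        using union(1) by (intro P.finite_measure_UNION) (auto simp: disjoint_family_on_def)
      then show "(\<lambda>i. measure PM (A n \<inter> B i)) sums measure PM (A n \<inter> (\<Union>i. B i))" by simp
      show "(\<lambda>i. measure PM (A n) * measure PM (B i)) sums (measure PM (A n) * measure PM (\<Union>i. B i))"
        by (rule sums_mult[OF sB])
    qed
    ultimately show ?case by simp
  qed
qed

text \<open>Extension from indicators to integrable functions. In the approximation step, replacing
  d costs at most twice the L1 distance, uniformly in n.\<close>

lemma integral_future_tendsto:
  fixes d :: "(nat \<Rightarrow> 'b) \<Rightarrow> real"
  assumes d: "integrable PM d"
    and A [measurable]: "\<And>n. A n \<in> sets PM"
    and future: "\<And>n x y. x \<in> space PM \<Longrightarrow> y \<in> space PM \<Longrightarrow> \<forall>i\<ge>n. x i = y i \<Longrightarrow> x \<in> A n \<longleftrightarrow> y \<in> A n"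
  shows "(\<lambda>n. (LINT x|PM. indicator (A n) x * d x) - measure PM (A n) * (LINT x|PM. d x)) \<longlonglongrightarrow> 0"
  using d
proof (induction rule: integrable_induct)
  case (base B c)
  then have [measurable]: "B \<in> sets PM" by simp
  have "(LINT x|PM. indicator (A n) x * (indicator B x *\<^sub>R c)) = c * measure PM (A n \<inter> B)" for n
  proof -
    have "(LINT x|PM. indicator (A n) x * (indicator B x *\<^sub>R c)) = (LINT x|PM. indicator (A n \<inter> B) x * c)"
      by (intro Bochner_Integration.integral_cong) (auto simp: indicator_def)
    then show ?thesis by simp
  qed
  then have "(LINT x|PM. indicator (A n) x * (indicator B x *\<^sub>R c)) - measure PM (A n) * (LINT x|PM. indicator B x *\<^sub>R c)
    = c * (measure PM (A n \<inter> B) - measure PM (A n) * measure PM B)" for n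
    by (simp add: algebra_simps)
  moreover have "(\<lambda>n. measure PM (A n \<inter> B) - measure PM (A n) * measure PM B) \<longlonglongrightarrow> 0"
    by (rule prob_Int_future_tendsto[OF \<open>B \<in> sets PM\<close> A future])
  then have "(\<lambda>n. c * (measure PM (A n \<inter> B) - measure PM (A n) * measure PM B)) \<longlonglongrightarrow> 0"
    by (rule tendsto_mult_right_zero)
  ultimately show ?case by simp
next
  case (add d d')
  have int: "integrable PM (\<lambda>x. indicator (A n) x * e x)" if "integrable PM e" for e :: "(nat \<Rightarrow> 'b) \<Rightarrow> real" and n
    by (rule Bochner_Integration.integrable_bound[OF that]) (use that in \<open>auto simp: indicator_def\<close>)
  show ?case
    using tendsto_add[OF add(3,4)] add(1,2) int[OF add(1)] int[OF add(2)] by (simp add: algebra_simps)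
next
  case (lim d s)
  have int: "integrable PM (\<lambda>x. indicator (A n) x * e x)" if "integrable PM e" for e :: "(nat \<Rightarrow> 'b) \<Rightarrow> real" and n
    by (rule Bochner_Integration.integrable_bound[OF that]) (use that in \<open>auto simp: indicator_def\<close>)
  let ?a = "\<lambda>e n. (LINT x|PM. indicator (A n) x * e x) - measure PM (A n) * (LINT x|PM. e x)"
  have close: "\<bar>?a d n - ?a e n\<bar> \<le> 2 * (LINT x|PM. \<bar>d x - e x\<bar>)" if e: "integrable PM e" for e n
  proof -
    note i = int[OF lim(4), of n] int[OF e, of n] lim(4) e
    have "?a d n - ?a e n = (LINT x|PM. indicator (A n) x * (d x - e x)) - measure PM (A n) * (LINT x|PM. d x - e x)"
      using i by (simp add: right_diff_distrib)
    moreover have "\<bar>LINT x|PM. indicator (A n) x * (d x - e x)\<bar> \<le> (LINT x|PM. \<bar>d x - e x\<bar>)"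
    proof (rule order_trans[OF integral_abs_bound integral_mono])
      show "integrable PM (\<lambda>x. \<bar>indicator (A n) x * (d x - e x)\<bar>)"
        using int[OF Bochner_Integration.integrable_diff[OF lim(4) e]] by (rule integrable_abs)
    qed (use i in \<open>auto simp: indicator_def\<close>)
    moreover have "\<bar>measure PM (A n) * (LINT x|PM. d x - e x)\<bar> \<le> (LINT x|PM. \<bar>d x - e x\<bar>)"
      unfolding abs_mult
      by (rule order_trans[OF mult_left_le_one_le integral_abs_bound]) auto
    ultimately show ?thesis by linarith
  qed
  have "(\<lambda>i. LINT x|PM. \<bar>d x - s i x\<bar>) \<longlonglongrightarrow> (LINT x|PM. 0)"
  \<comment> \<open>The approximating functions are bounded by 2 |d|, hence the factor 3.\<close>
  proof (rule integral_dominated_convergence[where w = "\<lambda>x. 3 * \<bar>d x\<bar>"])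
    show "AE x in PM. norm \<bar>d x - s i x\<bar> \<le> 3 * \<bar>d x\<bar>" for i
      using lim(3)[of _ i] by (intro AE_I2) fastforce
    show "AE x in PM. (\<lambda>i. \<bar>d x - s i x\<bar>) \<longlonglongrightarrow> 0"
    proof (intro AE_I2 tendsto_rabs_zero)
      fix x assume "x \<in> space PM"
      from tendsto_diff[OF tendsto_const[of "d x"] lim(2)[OF this]]
      show "(\<lambda>i. d x - s i x) \<longlonglongrightarrow> 0" by simp
    qed
  qed (use lim in auto)
  then have small: "(\<lambda>i. LINT x|PM. \<bar>d x - s i x\<bar>) \<longlonglongrightarrow> 0" by simp
  show ?case
  proof (rule LIMSEQ_I)
    fix e :: real assume "0 < e"
    then have "\<forall>\<^sub>F i in sequentially. (LINT x|PM. \<bar>d x - s i x\<bar>) < e / 4"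
      using small by (intro order_tendstoD(2)) auto
    then obtain i where i: "(LINT x|PM. \<bar>d x - s i x\<bar>) < e / 4"
      by (auto simp: eventually_sequentially)
    obtain k where k: "\<And>n. k \<le> n \<Longrightarrow> norm (?a (s i) n - 0) < e / 2"
      using LIMSEQ_D[OF lim(5)[of i], of "e / 2"] \<open>0 < e\<close> by auto
    have "norm (?a d n - 0) < e" if "k \<le> n" for n
      using k[OF that] close[OF lim(1), of n i] i unfolding real_norm_def by linarith
    then show "\<exists>k. \<forall>n\<ge>k. norm (?a d n - 0) < e" by blast
  qed
qed

end

text \<open>Unconditional and absolute summability coincide for real series, so a Bochner integral
  can be read as the kind of sum that occurs in \<open>ruelle\<close>.\<close>

lemma (in positive_weight) integral_weighted_measure:
  assumes "integrable (weighted_measure w) k"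
  shows "(LINT a|weighted_measure w. k a) = (\<Sum>\<^sub>\<infinity>a. w a * k a) / (\<Sum>\<^sub>\<infinity>a. w a)"
proof -
  let ?W = "\<Sum>\<^sub>\<infinity>a. w a"
  have nn: "AE a in count_space UNIV. 0 \<le> w a / ?W"
    using pos infsum_pos by (simp add: less_imp_le)
  have "integrable (count_space UNIV) (\<lambda>a. w a / ?W * k a)"
    using assms nn unfolding weighted_measure_def by (subst (asm) integrable_density) auto
  then have "Infinite_Set_Sum.abs_summable_on (\<lambda>a. w a / ?W * k a) UNIV"
    by (simp add: Infinite_Set_Sum.abs_summable_on_def)
  then have "(LINT a|count_space UNIV. w a / ?W * k a) = (\<Sum>\<^sub>\<infinity>a. w a / ?W * k a)"
    unfolding infsetsum_def[symmetric] by (simp add: abs_summable_equivalent infsetsum_infsum)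
  also have "(LINT a|count_space UNIV. w a / ?W * k a) = (LINT a|weighted_measure w. k a)"
    using nn unfolding weighted_measure_def by (subst integral_density) auto
  also have "(\<Sum>\<^sub>\<infinity>a. w a / ?W * k a) = (\<Sum>\<^sub>\<infinity>a. inverse ?W * (w a * k a))"
    by (simp add: field_simps)
  also have "\<dots> = (\<Sum>\<^sub>\<infinity>a. w a * k a) / ?W"
    by (subst infsum_cmult_right') (simp add: field_simps)
  finally show ?thesis .
qed

section \<open>The Ruelle operator on the fibres of the shift\<close>

lemma shift_case_nat [simp]: "shift (case_nat a x) = x"
  by (simp add: shift_def)

lemma ruelle_eq: "ruelle g \<phi> x = (\<Sum>\<^sub>\<infinity>a. \<phi> (case_nat a x) * g (case_nat a x))"
proof -
  have "{y. shift y = x} = range (\<lambda>a. case_nat a x)"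
  proof (intro equalityI subsetI)
    fix y assume "y \<in> {y. shift y = x}"
    then have "y = case_nat (y 0) x" by (auto simp: shift_def fun_eq_iff split: nat.split)
    then show "y \<in> range (\<lambda>a. case_nat a x)" by blast
  qed auto
  moreover have "inj (\<lambda>a. case_nat a x)"
    by (rule injI) (metis nat.case(1))
  ultimately show ?thesis
    unfolding ruelle_def by (simp add: infsum_reindex o_def)
qed

lemma funpow_shift: "(shift ^^ n) x i = x (i + n)"
  by (induction n arbitrary: i) (simp_all add: shift_def)

context potential
begin

text \<open>The part of \<open>g (case_nat a x)\<close> that does not depend on the letter a. Up to
  a constant it is also the density of the image of \<open>mu f\<close> under the shift.\<close>

definition shifted_prod :: "(nat \<Rightarrow> 'a) \<Rightarrow> real" where
  "shifted_prod x = (\<Prod>i. f (Suc i) (x i))"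

lemma shifted_prod_has_prod: "(\<lambda>i. f (Suc i) (x i)) has_prod shifted_prod x"
  and shifted_prod_pos: "0 < shifted_prod x"
  and g_case_nat: "g (case_nat a x) = g0 * f 0 a * shifted_prod x"
proof -
  let ?y = "case_nat a x :: nat \<Rightarrow> 'a"
  \<comment> \<open>The hypothesis covers every sequence, so it applies to x preceded by an
    arbitrary letter; dropping the head keeps summability.\<close>
  have s: "summable (\<lambda>i. ln (f (Suc i) (x i)))"
    using summable_ln[of "case_nat undefined x"] by (subst (asm) summable_Suc_iff[symmetric]) simp
  have hp: "(\<lambda>i. f (Suc i) (x i)) has_prod exp (\<Sum>i. ln (f (Suc i) (x i)))"
    by (intro has_prod_exp_suminf f_pos s)
  then show "(\<lambda>i. f (Suc i) (x i)) has_prod shifted_prod x"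
    unfolding shifted_prod_def using has_prod_unique by metis
  have e: "shifted_prod x = exp (\<Sum>i. ln (f (Suc i) (x i)))"
    unfolding shifted_prod_def by (rule has_prod_unique[symmetric, OF hp])
  then show "0 < shifted_prod x" by simp
  have "(\<lambda>i. f i (?y i)) has_prod exp (\<Sum>i. ln (f i (?y i)))"
    by (intro has_prod_exp_suminf f_pos summable_ln)
  then have "(\<Prod>i. f i (?y i)) = exp (\<Sum>i. ln (f i (?y i)))" by (rule has_prod_unique[symmetric])
  also have "(\<Sum>i. ln (f i (?y i))) = (\<Sum>i. ln (f (Suc i) (x i))) + ln (f 0 a)"
    using suminf_split_head[OF summable_ln[of ?y]] by simp
  also have "exp \<dots> = f 0 a * shifted_prod x"
    by (simp add: exp_add e f_pos)
  finally show "g ?y = g0 * f 0 a * shifted_prod x" by (simp add: g_eq)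
qed

lemma shifted_partial_prod_tendsto: "(\<lambda>n. \<Prod>j<n. f (Suc j) (x j)) \<longlonglongrightarrow> shifted_prod x"
  using has_prod_imp_tendsto'[OF shifted_prod_has_prod] .

lemma Z_pos: "0 < Z n" and Z_lim_pos: "0 < Z_lim"
  by (rule W.infsum_pos, rule Wlim.infsum_pos)

lemma eigenvalue_eq: "ruelle_eigenvalue g0 f = g0 * Z_lim"
  by (simp add: ruelle_eigenvalue_def weight_lim_def[abs_def])

text \<open>Prepending a letter moves coordinate n of x to position n + 1, where the tail of the
  potential lacks the factor \<open>f (Suc n)\<close>. So consecutive factors differ by that factor
  and a quotient of totals, and the quotients telescope to \<open>Z n / Z 0\<close>.\<close>

lemma partial_prod_case_nat:
  "(\<Prod>j<Suc n. h_factor f (case_nat a x) j) =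
    to_lim.ratio 0 a * (\<Prod>j<n. h_factor f x j) * (Z n / Z 0) / (\<Prod>j<n. f (Suc j) (x j))"
proof (induction n)
  case 0
  then show ?case using Z_pos[of 0] by (simp add: h_factor_eq_ratio)
next
  case (Suc n)
  have "tail n b = ln (f (Suc n) b) + tail (Suc n) b" for b
    using suminf_split_head[OF summable_ln_tail[of "Suc n" b]] by (simp add: tail_def)
  then have "exp (tail n b) = f (Suc n) b * exp (tail (Suc n) b)" for b
    by (simp add: exp_add f_pos)
  then have "to_lim.ratio (Suc n) b = to_lim.ratio n b * (Z (Suc n) / Z n) / f (Suc n) b" for b
    using Z_pos[of n] f_pos[of "Suc n" b] by (simp add: ratio_to_lim)
  then have step: "h_factor f (case_nat a x) (Suc n) = h_factor f x n * (Z (Suc n) / Z n) / f (Suc n) (x n)"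
    by (simp add: h_factor_eq_ratio)
  have "(\<Prod>j<Suc (Suc n). h_factor f (case_nat a x) j)
      = (\<Prod>j<Suc n. h_factor f (case_nat a x) j) * h_factor f (case_nat a x) (Suc n)"
    by (rule prod.lessThan_Suc)
  then show ?case
    unfolding Suc.IH step using Z_pos[of n] by (simp add: field_simps)
qed

text \<open>All correction factors have positive limits at every point, so the identity needs no
  exceptional set. Where the limit fails to exist, both sides vanish by the default value of
  \<open>h_mu\<close>.\<close>

lemma h_mu_case_nat:
  "h_mu f (case_nat a x) * shifted_prod x * Z 0 = to_lim.ratio 0 a * h_mu f x * Z_lim"
proof (cases "h_mu_exists f x")
  case True
  then have L: "(\<lambda>n. \<Prod>j<n. h_factor f x j) \<longlonglongrightarrow> h_mu f x"
    using h_mu_eqI(2) by (auto simp: h_mu_exists_def)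
  have "(\<lambda>n. to_lim.ratio 0 a * (\<Prod>j<n. h_factor f x j) * (Z n / Z 0) / (\<Prod>j<n. f (Suc j) (x j)))
      \<longlonglongrightarrow> to_lim.ratio 0 a * h_mu f x * (Z_lim / Z 0) / shifted_prod x"
    using Z_pos[of 0] shifted_prod_pos[of x]
    by (intro tendsto_intros L Z_tendsto shifted_partial_prod_tendsto) auto
  then have "(\<lambda>n. \<Prod>j<Suc n. h_factor f (case_nat a x) j)
      \<longlonglongrightarrow> to_lim.ratio 0 a * h_mu f x * (Z_lim / Z 0) / shifted_prod x"
    unfolding partial_prod_case_nat .
  then have "(\<lambda>n. \<Prod>j<n. h_factor f (case_nat a x) j)
      \<longlonglongrightarrow> to_lim.ratio 0 a * h_mu f x * (Z_lim / Z 0) / shifted_prod x"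
    by (rule LIMSEQ_imp_Suc)
  from h_mu_eqI(2)[OF this] show ?thesis
    using Z_pos[of 0] shifted_prod_pos[of x] by simp
next
  case False
  \<comment> \<open>The correction factors can be divided out again, so existence at the prolonged
    sequence would give existence at x.\<close>
  have "\<not> h_mu_exists f (case_nat a x)"
  proof
    assume "h_mu_exists f (case_nat a x)"
    then obtain L where "(\<lambda>n. \<Prod>j<n. h_factor f (case_nat a x) j) \<longlonglongrightarrow> L"
      by (auto simp: h_mu_exists_def)
    then have L: "(\<lambda>n. \<Prod>j<Suc n. h_factor f (case_nat a x) j) \<longlonglongrightarrow> L" by (rule LIMSEQ_Suc)
    have "(\<lambda>n. (\<Prod>j<Suc n. h_factor f (case_nat a x) j) * (\<Prod>j<n. f (Suc j) (x j)) / (Z n / Z 0) / to_lim.ratio 0 a)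
        \<longlonglongrightarrow> L * shifted_prod x / (Z_lim / Z 0) / to_lim.ratio 0 a"
      using Z_pos[of 0] Z_lim_pos to_lim.ratio_pos[of 0 a]
      by (intro tendsto_intros L Z_tendsto shifted_partial_prod_tendsto) auto
    moreover have "(\<Prod>j<Suc n. h_factor f (case_nat a x) j) * (\<Prod>j<n. f (Suc j) (x j)) / (Z n / Z 0) / to_lim.ratio 0 a
        = (\<Prod>j<n. h_factor f x j)" for n
    proof -
      define p where "p = (\<Prod>j<n. f (Suc j) (x j))"
      define q where "q = (\<Prod>j<n. h_factor f x j)"
      have "0 < p" unfolding p_def by (intro prod_pos) (auto simp: f_pos)
      then show ?thesis
        unfolding partial_prod_case_nat p_def[symmetric] q_def[symmetric]
        using Z_pos[of 0] Z_pos[of n] to_lim.ratio_pos[of 0 a] by simp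
    qed
    ultimately show False using False h_mu_eqI(1) by simp
  qed
  then show ?thesis using False by (simp add: h_mu_def)
qed

text \<open>Each preimage contributes a multiple of \<open>weight_lim a\<close> by a quantity
  depending on x alone, so summing over the letters produces \<open>Z_lim\<close> and with it the
  eigenvalue.\<close>

lemma ruelle_h_mu: "ruelle g (h_mu f) x = ruelle_eigenvalue g0 f * h_mu f x"
proof -
  have "h_mu f (case_nat a x) * g (case_nat a x) = g0 * h_mu f x * weight_lim a" for a
  proof -
    have "to_lim.ratio 0 a * f 0 a = Z 0 / Z_lim * weight_lim a"
      by (simp add: ratio_to_lim weight_lim_eq[of a 0]) (simp add: weight_def)
    then have "h_mu f (case_nat a x) * shifted_prod x * Z 0 * f 0 a = h_mu f x * weight_lim a * Z 0"
      unfolding h_mu_case_nat using Z_lim_pos by (simp add: field_simps)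
    then show ?thesis using Z_pos[of 0] by (simp add: g_case_nat mult_ac)
  qed
  then show ?thesis by (simp add: ruelle_eq eigenvalue_eq infsum_cmult_right' mult_ac)
qed

section \<open>Duality of the Ruelle operator with the shift, and uniqueness\<close>

sublocale S: kakutani "\<lambda>n. weighted_measure (weight n)" "\<lambda>n. to_Suc.ratio n"
  by (rule kakutani_ratio) (rule to_Suc.weight_pair_axioms)

lemma summable_rho_to_Suc: "summable (\<lambda>j. 1 - S.rho j)"
proof (rule summable_comparison_test'[of _ 0])
  \<comment> \<open>The defect is quadratic in \<open>osc j\<close>; one factor \<open>osc j\<close>
    is kept for summability, and the rest is bounded by its value at
    \<open>osc_tail 0\<close>.\<close>
  let ?C = "osc_tail 0 * (exp (osc_tail 0))\<^sup>2 / 2"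
  show "summable (\<lambda>j. osc j * ?C)" by (rule summable_mult2[OF summable_osc])
  show "norm (1 - S.rho j) \<le> osc j * ?C" for j
  proof -
    have "1 - S.rho j \<le> (osc j * exp (osc j))\<^sup>2 / 2"
      by (rule S.one_minus_rho_le, rule to_Suc.abs_ln_ratio_le) (simp add: weight_Suc_quotient abs_ln_f_le)
    also have "(osc j * exp (osc j))\<^sup>2 = osc j * (osc j * (exp (osc j))\<^sup>2)"
      by (simp add: power2_eq_square)
    also have "\<dots> \<le> osc j * (osc_tail 0 * (exp (osc_tail 0))\<^sup>2)"
      using osc_le[of j] osc_nonneg[of j] by (intro mult_left_mono mult_mono power_mono) auto
    finally show ?thesis using S.rho_le_1[of j] by simp
  qed
qed

lemma measurable_shifted_prod [measurable]: "shifted_prod \<in> borel_measurable (mu f)"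
proof (rule borel_measurable_LIMSEQ_metric)
  show "(\<lambda>x. \<Prod>j<n. f (Suc j) (x j)) \<in> borel_measurable (mu f)" for n
    unfolding mu_eq by measurable
  show "(\<lambda>n. \<Prod>j<n. f (Suc j) (x j)) \<longlonglongrightarrow> shifted_prod x" for x
    by (rule shifted_partial_prod_tendsto)
qed

text \<open>The law of \<open>shift\<close> under \<open>mu f\<close>, by
  \<open>distr_case_nat\<close>.\<close>

abbreviation "mu_shift \<equiv> Pi\<^sub>M UNIV (\<lambda>n. weighted_measure (weight (Suc n)))"

text \<open>In the product of the consecutive ratios the totals telescope, and the remaining product
  of factors converges at every point.\<close>

lemma mu_shift_eq_density: "mu_shift = density (mu f) (\<lambda>x. ennreal (Z 0 / Z_lim * shifted_prod x))"
proof -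
  have "Pi\<^sub>M UNIV (\<lambda>n. density (weighted_measure (weight n)) (\<lambda>a. ennreal (to_Suc.ratio n a)))
      = density (mu f) (\<lambda>x. ennreal (Z 0 / Z_lim * shifted_prod x))"
    unfolding mu_eq
  proof (rule S.QM_eq_density[OF summable_rho_to_Suc])
    show "(\<lambda>x. Z 0 / Z_lim * shifted_prod x) \<in> borel_measurable (Pi\<^sub>M UNIV (\<lambda>n. weighted_measure (weight n)))"
      using measurable_shifted_prod unfolding mu_eq by measurable
    show "AE x in Pi\<^sub>M UNIV (\<lambda>n. weighted_measure (weight n)).
        (\<lambda>n. \<Prod>j<n. to_Suc.ratio j (x j)) \<longlonglongrightarrow> Z 0 / Z_lim * shifted_prod x"
    proof (rule AE_I2)
      fix x
      have "(\<Prod>j<n. to_Suc.ratio j (x j)) = Z 0 / Z n * (\<Prod>j<n. f (Suc j) (x j))" for n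
      proof (induction n)
        case (Suc n)
        then show ?case using Z_pos[of n] by (simp add: ratio_to_Suc)
      qed (use Z_pos[of 0] in simp)
      moreover have "(\<lambda>n. Z 0 / Z n * (\<Prod>j<n. f (Suc j) (x j))) \<longlonglongrightarrow> Z 0 / Z_lim * shifted_prod x"
        using Z_lim_pos by (intro tendsto_intros Z_tendsto shifted_partial_prod_tendsto) auto
      ultimately show "(\<lambda>n. \<Prod>j<n. to_Suc.ratio j (x j)) \<longlonglongrightarrow> Z 0 / Z_lim * shifted_prod x" by simp
    qed
  qed
  then show ?thesis by (simp add: to_Suc.density_ratio)
qed

lemma measurable_shift [measurable]: "shift \<in> measurable (mu f) (mu f)"
  unfolding mu_eq shift_def[abs_def]
  by (rule measurable_PiM_single') (auto simp: measurable_def weighted_measure_def)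

lemma space_mu [simp]: "space (mu f) = UNIV"
  by (simp add: mu_eq space_PiM)

text \<open>Split a point into its first letter and the rest, and use Fubini: the indicator depends
  on the rest only, whose law is \<open>mu_shift\<close>. The density of this law supplies the
  factor \<open>shifted_prod\<close> that separates the mean over the first letter from the Ruelle
  operator; \<open>Z 0\<close> cancels, and \<open>Z_lim\<close> is absorbed by the
  eigenvalue.\<close>

lemma integral_shift_eigenfunction:
  assumes h: "integrable (mu f) h"
    and eig: "AE x in mu f. ruelle g h x = ruelle_eigenvalue g0 f * h x"
    and S [measurable]: "S \<in> sets (mu f)"
  shows "(LINT x|mu f. indicator S (shift x) * h x) = (LINT x|mu f. indicator S x * h x)"
proof -
  define M0 where "M0 = weighted_measure (weight 0)"
  define l where "l x = Z 0 / Z_lim * shifted_prod x" for x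
  have l_pos: "0 < l x" for x
    using Z_pos[of 0] Z_lim_pos shifted_prod_pos[of x] by (simp add: l_def)
  have [measurable]: "l \<in> borel_measurable (mu f)" unfolding l_def by measurable
  have hm [measurable]: "h \<in> borel_measurable (mu f)" using h by auto
  interpret S': sequence_prob_space "\<lambda>n. weighted_measure (weight (Suc n))"
    by (intro sequence_prob_spaceI W.prob_space_weighted_measure)
  interpret M0: prob_space M0 unfolding M0_def by (rule W.prob_space_weighted_measure)
  interpret pair_sigma_finite M0 mu_shift ..
  have cons: "(\<lambda>(a, x). case_nat a x) \<in> measurable (M0 \<Otimes>\<^sub>M mu_shift) (mu f)"
    unfolding M0_def mu_eq by (rule K.measurable_case_nat)
  have distr: "distr (M0 \<Otimes>\<^sub>M mu_shift) (mu f) (\<lambda>(a, x). case_nat a x) = mu f"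
    unfolding M0_def mu_eq by (rule K.distr_case_nat)
  define v where "v x = indicator S (shift x) * h x" for x
  have v: "integrable (mu f) v"
    unfolding v_def by (rule Bochner_Integration.integrable_bound[OF h]) (auto simp: indicator_def)
  have pair: "integrable (M0 \<Otimes>\<^sub>M mu_shift) (\<lambda>(a, x). u (case_nat a x))"
    if "integrable (mu f) u" for u :: "(nat \<Rightarrow> 'a) \<Rightarrow> real"
    using integrable_distr[OF cons, unfolded distr, of u] that by (simp add: split_beta')
  have "(LINT x|mu f. v x) = (LINT p|(M0 \<Otimes>\<^sub>M mu_shift). v ((\<lambda>(a, x). case_nat a x) p))"
    using v by (subst distr[symmetric], intro integral_distr cons) auto
  also have "\<dots> = (LINT x|mu_shift. LINT a|M0. v (case_nat a x))"
    using integral_snd[OF pair[OF v]] by (simp add: split_beta')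
  also have "\<dots> = (LINT x|mu f. l x *\<^sub>R (LINT a|M0. v (case_nat a x)))"
    unfolding mu_shift_eq_density l_def[symmetric]
  proof (rule integral_density)
    have "(\<lambda>x. LINT a|M0. v (case_nat a x)) \<in> borel_measurable mu_shift"
      using integrable_snd[OF pair[OF v]] by (rule borel_measurable_integrable)
    then show "(\<lambda>x. LINT a|M0. v (case_nat a x)) \<in> borel_measurable (mu f)"
      unfolding mu_shift_eq_density by simp
    show "AE x in mu f. 0 \<le> l x" using l_pos by (simp add: less_imp_le)
  qed measurable
  also have "\<dots> = (LINT x|mu f. indicator S x * h x)"
  proof (rule integral_cong_AE)
    have "(\<lambda>x. LINT a|M0. v (case_nat a x)) \<in> borel_measurable mu_shift"
      using integrable_snd[OF pair[OF v]] by (rule borel_measurable_integrable)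
    then have "(\<lambda>x. LINT a|M0. v (case_nat a x)) \<in> borel_measurable (mu f)"
      unfolding mu_shift_eq_density by simp
    then show "(\<lambda>x. l x *\<^sub>R (LINT a|M0. v (case_nat a x))) \<in> borel_measurable (mu f)" by measurable
    \<comment> \<open>Integrability on a fibre is needed to identify the Bochner integral with the
      sum. Fubini gives it almost everywhere for \<open>mu_shift\<close>, and positivity of
      \<open>l\<close> carries it over to \<open>mu f\<close>.\<close>
    have "AE x in mu_shift. integrable M0 (\<lambda>a. h (case_nat a x))"
      using AE_integrable_snd[OF pair[OF h]] .
    then have "AE x in mu f. integrable M0 (\<lambda>a. h (case_nat a x))"
      unfolding mu_shift_eq_density l_def[symmetric] by (subst (asm) AE_density) (auto simp: l_pos)
    then show "AE x in mu f. l x *\<^sub>R (LINT a|M0. v (case_nat a x)) = indicator S x * h x"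
      using eig
    proof eventually_elim
      case (elim x)
      have "(LINT a|M0. v (case_nat a x)) = indicator S x * (LINT a|M0. h (case_nat a x))"
        unfolding v_def by simp
      also have "(LINT a|M0. h (case_nat a x)) = (\<Sum>\<^sub>\<infinity>a. weight 0 a * h (case_nat a x)) / Z 0"
        unfolding M0_def by (rule W.integral_weighted_measure) (use elim in \<open>simp add: M0_def\<close>)
      finally have 1: "(LINT a|M0. v (case_nat a x)) = indicator S x * ((\<Sum>\<^sub>\<infinity>a. weight 0 a * h (case_nat a x)) / Z 0)" .
      have "ruelle g h x = (\<Sum>\<^sub>\<infinity>a. g0 * shifted_prod x * (weight 0 a * h (case_nat a x)))"
        unfolding ruelle_eq by (intro infsum_cong) (simp add: g_case_nat weight_def)
      then have "g0 * Z_lim * h x = g0 * shifted_prod x * (\<Sum>\<^sub>\<infinity>a. weight 0 a * h (case_nat a x))"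
        using elim(2) by (simp only: infsum_cmult_right' eigenvalue_eq)
      then have "h x = shifted_prod x / Z_lim * (\<Sum>\<^sub>\<infinity>a. weight 0 a * h (case_nat a x))"
        using g0_pos Z_lim_pos by (simp add: field_simps)
      then show ?case unfolding 1 l_def using Z_pos[of 0] by simp
    qed
  qed measurable
  finally show ?thesis unfolding v_def .
qed

lemma integral_eigenfunction_funpow_shift:
  assumes h: "integrable (mu f) h"
    and eig: "AE x in mu f. ruelle g h x = ruelle_eigenvalue g0 f * h x"
    and S: "S \<in> sets (mu f)"
  shows "(LINT x|mu f. indicator ((shift ^^ n) -` S) x * h x) = (LINT x|mu f. indicator S x * h x)"
proof (induction n)
  case (Suc n)
  have m: "(shift ^^ n) \<in> measurable (mu f) (mu f)" by (rule measurable_compose_n) simp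
  have "(shift ^^ n) -` S \<in> sets (mu f)" using measurable_sets[OF m S] by simp
  from integral_shift_eigenfunction[OF h eig this]
  have "(LINT x|mu f. indicator ((shift ^^ n) -` S) (shift x) * h x) = (LINT x|mu f. indicator S x * h x)"
    unfolding Suc .
  then show ?case by (simp add: indicator_def funpow_Suc_right del: funpow.simps)
qed simp

text \<open>The integral of an eigenfunction over S equals its integral over \<open>A n\<close> for
  every n, and \<open>A n\<close> depends on the coordinates from n on only. By asymptotic
  independence it is therefore the limit of the measures of \<open>A n\<close>, which is the same
  for \<open>h\<close> and \<open>h'\<close>.\<close>

lemma eigenfunction_unique:
  assumes h: "integrable (mu f) h" "AE x in mu f. ruelle g h x = ruelle_eigenvalue g0 f * h x"
      "(LINT x|mu f. h x) = 1"
    and h': "integrable (mu f) h'" "AE x in mu f. ruelle g h' x = ruelle_eigenvalue g0 f * h' x"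
      "(LINT x|mu f. h' x) = 1"
  shows "AE x in mu f. h x = h' x"
proof -
  have int: "integrable (mu f) (\<lambda>x. indicator S x * u x)"
    if "S \<in> sets (mu f)" "integrable (mu f) u" for S and u :: "(nat \<Rightarrow> 'a) \<Rightarrow> real"
    by (rule Bochner_Integration.integrable_bound[OF that(2)]) (use that in \<open>auto simp: indicator_def\<close>)
  have eq: "(LINT x|mu f. indicator S x * h x) = (LINT x|mu f. indicator S x * h' x)"
    if S: "S \<in> sets (mu f)" for S
  proof -
    define A where "A n = (shift ^^ n) -` S" for n
    have A: "A n \<in> sets (mu f)" for n
    proof -
      have m: "(shift ^^ n) \<in> measurable (mu f) (mu f)" by (rule measurable_compose_n) simp
      show ?thesis using measurable_sets[OF m S] by (simp add: A_def)
    qed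
    have future: "x \<in> A n \<longleftrightarrow> y \<in> A n" if "\<forall>i\<ge>n. x i = y i" for n x y
    proof -
      have "(shift ^^ n) x = (shift ^^ n) y" using that by (auto simp: funpow_shift fun_eq_iff)
      then show ?thesis by (simp add: A_def)
    qed
    have lim: "(\<lambda>n. (LINT x|mu f. indicator (A n) x * u x) - measure (mu f) (A n) * (LINT x|mu f. u x)) \<longlonglongrightarrow> 0"
      if "integrable (mu f) u" for u
      using that A future unfolding mu_eq by (intro K.integral_future_tendsto) auto
    have "(\<lambda>n. (LINT x|mu f. indicator S x * h x) - measure (mu f) (A n)) \<longlonglongrightarrow> 0"
      using lim[OF h(1)] by (simp add: A_def integral_eigenfunction_funpow_shift[OF h(1,2) S] h(3))
    moreover have "(\<lambda>n. (LINT x|mu f. indicator S x * h' x) - measure (mu f) (A n)) \<longlonglongrightarrow> 0"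
      using lim[OF h'(1)] by (simp add: A_def integral_eigenfunction_funpow_shift[OF h'(1,2) S] h'(3))
    ultimately have "(\<lambda>n. (LINT x|mu f. indicator S x * h x) - (LINT x|mu f. indicator S x * h' x)) \<longlonglongrightarrow> 0 - 0"
      by (auto dest: tendsto_diff)
    then show ?thesis by (simp add: LIMSEQ_const_iff)
  qed
  define d where "d x = h x - h' x" for x
  have d [measurable]: "integrable (mu f) d" unfolding d_def using h(1) h'(1) by simp
  have [measurable]: "d \<in> borel_measurable (mu f)" using d by auto
  have zero: "(LINT x|mu f. indicator S x * d x) = 0" if S: "S \<in> sets (mu f)" for S
    unfolding d_def right_diff_distrib using int[OF S h(1)] int[OF S h'(1)] eq[OF S] by simp
  \<comment> \<open>Stated for a general \<open>e\<close> so that it serves both signs: testing on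
    the sets where \<open>d\<close> and \<open>- d\<close> are positive kills the positive and the
    negative part.\<close>
  have sgn: "AE x in mu f. indicator {x. 0 < e x} x * e x = 0"
    if e: "integrable (mu f) e" and z: "\<And>S. S \<in> sets (mu f) \<Longrightarrow> (LINT x|mu f. indicator S x * e x) = 0"
    for e :: "(nat \<Rightarrow> 'a) \<Rightarrow> real"
  proof -
    have [measurable]: "e \<in> borel_measurable (mu f)" using e by auto
    have "{x \<in> space (mu f). 0 < e x} \<in> sets (mu f)" by measurable
    then have S: "{x. 0 < e x} \<in> sets (mu f)" by simp
    show ?thesis
      using z[OF S] int[OF S e] by (subst (asm) integral_nonneg_eq_0_iff_AE) (auto simp: indicator_def)
  qed
  have "AE x in mu f. indicator {x. 0 < d x} x * d x = 0" by (rule sgn[OF d zero])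
  moreover have "AE x in mu f. indicator {x. 0 < - d x} x * - d x = 0"
    by (rule sgn) (use d zero in auto)
  ultimately show ?thesis
  proof eventually_elim
    case (elim x)
    then have "d x = 0" by (cases "d x" "0 :: real" rule: linorder_cases) auto
    then show ?case by (simp add: d_def)
  qed
qed

end

theorem theorem4p3:
  fixes g :: "(nat \<Rightarrow> 'a :: countable) \<Rightarrow> real"
    and g0 :: real
    and f :: "nat \<Rightarrow> 'a \<Rightarrow> real"
  assumes "product_type g g0 f"
    and "l1_bounded f"
    and "summable_potential f"
  shows
    "(\<forall>h h'.
        integrable (mu f) h \<and>
        (AE x in mu f. ruelle g h x = ruelle_eigenvalue g0 f * h x) \<and>
        (LINT x|mu f. h x) = 1 \<and>
        integrable (mu f) h' \<and>
        (AE x in mu f. ruelle g h' x = ruelle_eigenvalue g0 f * h' x) \<and>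
        (LINT x|mu f. h' x) = 1
        \<longrightarrow> (AE x in mu f. h x = h' x))
     \<and>
     ((\<exists>k. (\<Sum>i. SUP a. ennreal ((\<Sum>j. ln (f (j + (i + k)) a))\<^sup>2)) < \<infinity>)
        \<longrightarrow> integrable (mu f) (h_mu f) \<and>
            (LINT x|mu f. h_mu f x) = 1 \<and>
            (AE x in mu f. ruelle g (h_mu f) x = ruelle_eigenvalue g0 f * h_mu f x) \<and>
            mu_tilde f = density (mu f) (\<lambda>x. ennreal (h_mu f x)))
     \<and>
     ((AE x in mu f. h_mu_exists f x) \<and>
      ((\<integral>\<^sup>+ x. ennreal (h_mu f x) \<partial>mu f) > 0 \<longleftrightarrow> equivalent_measures (mu f) (mu_tilde f)) \<and>
      ((\<integral>\<^sup>+ x. ennreal (h_mu f x) \<partial>mu f) = 0 \<longrightarrow> singular_measures (mu_tilde f) (mu f)))"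
proof -
  interpret potential g g0 f by (rule potential.intro[OF assms])
  show ?thesis
  proof (intro conjI impI)
    show "\<forall>h h'.
        integrable (mu f) h \<and>
        (AE x in mu f. ruelle g h x = ruelle_eigenvalue g0 f * h x) \<and>
        (LINT x|mu f. h x) = 1 \<and>
        integrable (mu f) h' \<and>
        (AE x in mu f. ruelle g h' x = ruelle_eigenvalue g0 f * h' x) \<and>
        (LINT x|mu f. h' x) = 1
        \<longrightarrow> (AE x in mu f. h x = h' x)"
      by (intro allI impI, elim conjE, rule eigenfunction_unique, assumption+)
  next
    assume "\<exists>k. (\<Sum>i. SUP a. ennreal ((\<Sum>j. ln (f (j + (i + k)) a))\<^sup>2)) < \<infinity>"
    then have sm: "summable (\<lambda>j. 1 - K.rho j)" using summable_rho_if_square_summable by blast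
    have "has_bochner_integral (mu f) (h_mu f) 1"
      by (rule has_bochner_integral_nn_integral) (use summable_case(3)[OF sm] h_mu_nonneg in auto)
    then show "integrable (mu f) (h_mu f)" "(LINT x|mu f. h_mu f x) = 1"
      by (auto simp: has_bochner_integral_iff)
    show "AE x in mu f. ruelle g (h_mu f) x = ruelle_eigenvalue g0 f * h_mu f x"
      by (simp add: ruelle_h_mu)
    show "mu_tilde f = density (mu f) (\<lambda>x. ennreal (h_mu f x))"
      by (rule summable_case(2)[OF sm])
  next
    show "AE x in mu f. h_mu_exists f x" by (rule h_mu_exists_AE)
  next
    show "(\<integral>\<^sup>+ x. ennreal (h_mu f x) \<partial>mu f) > 0 \<longleftrightarrow> equivalent_measures (mu f) (mu_tilde f)"
    \<comment> \<open>The integral of \<open>h_mu\<close> is 1 in the summable case and 0 otherwise;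
      no other value occurs.\<close>
    proof (cases "summable (\<lambda>j. 1 - K.rho j)")
      case True
      then show ?thesis using summable_case(3) summable_case_equivalent by simp
    next
      case False
      have "(\<integral>\<^sup>+ x. ennreal (h_mu f x) \<partial>mu f) = (\<integral>\<^sup>+ x. 0 \<partial>mu f)"
        using nonsummable_case(1)[OF False] by (intro nn_integral_cong_AE) (auto elim: eventually_mono)
      then show ?thesis using nonsummable_case_singular(2)[OF False] by simp
    qed
  next
    assume "(\<integral>\<^sup>+ x. ennreal (h_mu f x) \<partial>mu f) = 0"
    then have "\<not> summable (\<lambda>j. 1 - K.rho j)" using summable_case(3) by auto
    then show "singular_measures (mu_tilde f) (mu f)" by (rule nonsummable_case_singular(1))
  qed
qed

end
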